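(* Let $\Theta$ be a state-rendering map, let $\star$ be the associated state over time function given by $\Phi\star\sigma=(\Theta_{\sigma}\otimes\mathrm{id})(\mathscr{D}[\Phi])$, let $\mathcal{E}:\mathcal{A}\to\mathcal{B}$ be a CPTP map between multi-matrix algebras, and let $\rho\in\mathcal{S}(\mathcal{A})$. Let $\mathcal{E}_{\Theta,\rho}:\mathcal{A}\to\mathcal{B}$ be a generalized conditional expectation, i.e. a linear map such that $$\mathcal{E}\circ\Theta_{\rho}=\Theta_{\mathcal{E}(\rho)}\circ\mathcal{E}_{\Theta,\rho}.$$ Then its Hilbert–Schmidt adjoint $\mathcal{E}_{\Theta,\rho}^*:\mathcal{B}\to\mathcal{A}$ is a Bayes map for $(\mathcal{E},\rho)$ associated with $\star$.
   Context: A multi-matrix algebra is a finite direct sum $\mathcal{A}=\bigoplus_{x\in X}\mathbb{M}_{m_x}$ of complex matrix algebras ($X$ a finite set, $m_x$ positive integers), with componentwise multiplication and componentwise conjugate transpose $\dagger$; $1_{\mathcal{A}}$ is its unit and $\mathrm{tr}(A)=\sum_x\mathrm{tr}(A_x)$ its (un-normalized) trace. A state is a positive element of trace $1$; $\mathcal{S}(\mathcal{A})$ is the set of states. CPTP means completely positive and trace-preserving. The Hilbert–Schmidt inner product is $\langle A,A'\rangle=\mathrm{tr}(A^{\dagger}A')$, and the Hilbert–Schmidt adjoint $\Phi^*:\mathcal{B}\to\mathcal{A}$ of a linear map $\Phi:\mathcal{A}\to\mathcal{B}$ is defined by $\mathrm{tr}(\Phi(A)^{\dagger}B)=\mathrm{tr}(A^{\dagger}\Phi^*(B))$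 for all $A\in\mathcal{A}$, $B\in\mathcal{B}$. Let $\mu_{\mathcal{A}}:\mathcal{A}\otimes\mathcal{A}\to\mathcal{A}$ be the multiplication map, determined by $A_1\otimes A_2\mapsto A_1A_2$. The channel state of a linear map $\Phi:\mathcal{A}\to\mathcal{B}$ is $\mathscr{D}[\Phi]=(\mathrm{id}_{\mathcal{A}}\otimes\Phi)(\mu_{\mathcal{A}}^*(1_{\mathcal{A}}))\in\mathcal{A}\otimes\mathcal{B}$. A state-rendering map $\Theta$ assigns to every multi-matrix algebra $\mathcal{A}$ and every state $\rho\in\mathcal{S}(\mathcal{A})$ a linear map $\Theta_{\rho}:\mathcal{A}\to\mathcal{A}$ such that: (T1) $\Theta_{\rho}(A)=\rho A$ whenever $A\in\mathcal{A}$ satisfies $[\rho,A]=0$; (T2) $\Theta_{\rho}\circ\mathcal{E}^{-1}=\mathcal{E}^{-1}\circ\Theta_{\mathcal{E}(\rho)}$ whenever $\mathcal{E}$ is a $*$-isomorphism from $\mathcal{A}$ to a multi-matrix algebra; (T3) if $\mathcal{A}'$ is another multi-matrix algebra, then $\Theta_{\rho\otimes\rho'}=\Theta_{\rho}\otimes\Theta_{\rho'}$ for all $\rho\in\mathcal{S}(\mathcal{A})$, $\rho'\in\mathcal{S}(\mathcal{A}')$, provided that at least one of $\rho$ or $\rho'$ is in the center of $\mathcal{A}$ or $\mathcal{A}'$, respectively; (T4) $\Theta_{\rho}$ is self-adjoint and positive semi-definite with respect to the Hilbert–Schmidt inner product. The associated state over time function is $\Phi\star\sigma:=(\Theta_{\sigma}\otimes\mathrm{id}_{\mathcal{B}})(\mathscr{D}[\Phi])\in\mathcal{A}\otimes\mathcal{B}$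 for trace-preserving linear maps $\Phi:\mathcal{A}\to\mathcal{B}$ between multi-matrix algebras and $\sigma\in\mathcal{S}(\mathcal{A})$. A Bayes map for $(\mathcal{E},\rho)$ associated with $\star$ is a trace-preserving linear map $\mathcal{E}^{\star}_{\rho}:\mathcal{B}\to\mathcal{A}$ such that $\mathcal{E}\star\rho=\tau\big(\widetilde{\mathcal{E}^{\star}_{\rho}}\star\mathcal{E}(\rho)\big)$, where $\widetilde{\mathcal{E}^{\star}_{\rho}}(B):=\big(\mathcal{E}^{\star}_{\rho}(B^{\dagger})\big)^{\dagger}$ and $\tau:\mathcal{B}\otimes\mathcal{A}\to\mathcal{A}\otimes\mathcal{B}$ is the unique conjugate-linear map with $\tau(B\otimes A)=A^{\dagger}\otimes B^{\dagger}$.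
   Formalization: The adjoint need not be trace-preserving when Θ_{E(ρ)} is not injective, so the claim fails as stated; what is proved is that the Bayes equation always holds and that the adjoint is a Bayes map if and only if the generalized conditional expectation maps 1_A to 1_B. *)

theory Defs
  imports
    "Jordan_Normal_Form.Schur_Decomposition"
    "HOL-Library.FuncSet"
begin

section \<open>Multi-matrix algebras\<close>

text \<open>
  The algebra \<open>M_{m_0} \<oplus> \<dots> \<oplus> M_{m_{k-1}}\<close> is given by the list \<open>[m_0, \<dots>, m_{k-1}]\<close> of its block
  sizes, an element of it by the list of its blocks. Encoding algebras as values (not types) is what
  allows a state-rendering map to be quantified over all of them.
\<close>

type_synonym mm_alg = "nat list"
type_synonym mm = "complex mat list"

definition multi_matrix :: "mm_alg \<Rightarrow> bool" where
  "multi_matrix A \<longleftrightarrow> (\<forall>m\<in>set A. 0 < m)"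

definition mm_carrier :: "mm_alg \<Rightarrow> mm set" where
  "mm_carrier A = {a. length a = length A \<and> (\<forall>x<length A. a ! x \<in> carrier_mat (A ! x) (A ! x))}"

definition mm_one :: "mm_alg \<Rightarrow> mm" where
  "mm_one A = map (\<lambda>m. 1\<^sub>m m) A"

definition mm_add :: "mm \<Rightarrow> mm \<Rightarrow> mm" where
  "mm_add a b = map2 (+) a b"

definition mm_smult :: "complex \<Rightarrow> mm \<Rightarrow> mm" where
  "mm_smult c a = map (\<lambda>M. c \<cdot>\<^sub>m M) a"

definition mm_mult :: "mm \<Rightarrow> mm \<Rightarrow> mm" where
  "mm_mult a b = map2 (*) a b"

definition mm_dagger :: "mm \<Rightarrow> mm" where
  "mm_dagger a = map mat_adjoint a"

definition mm_trace :: "mm \<Rightarrow> complex" where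
  "mm_trace a = (\<Sum>M\<leftarrow>a. sum_list (diag_mat M))"

definition mm_inner :: "mm \<Rightarrow> mm \<Rightarrow> complex" where
  "mm_inner a b = mm_trace (mm_mult (mm_dagger a) b)"

definition mm_positive :: "mm_alg \<Rightarrow> mm \<Rightarrow> bool" where
  "mm_positive A a \<longleftrightarrow> (\<exists>c\<in>mm_carrier A. a = mm_mult (mm_dagger c) c)"

definition mm_states :: "mm_alg \<Rightarrow> mm set" where
  "mm_states A = {\<rho>\<in>mm_carrier A. mm_positive A \<rho> \<and> mm_trace \<rho> = 1}"

definition mm_center :: "mm_alg \<Rightarrow> mm set" where
  "mm_center A = {z\<in>mm_carrier A. \<forall>a\<in>mm_carrier A. mm_mult z a = mm_mult a z}"


section \<open>Linear maps\<close>

text \<open>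
  Linear maps are functions on \<^typ>\<open>mm\<close> of which only the values on the carrier of the domain
  matter. The parameter \<open>h\<close> is the identity for linear and \<^const>\<open>cnj\<close> for conjugate-linear maps.
\<close>

definition semilinear_map :: "(complex \<Rightarrow> complex) \<Rightarrow> mm_alg \<Rightarrow> mm_alg \<Rightarrow> (mm \<Rightarrow> mm) \<Rightarrow> bool" where
  "semilinear_map h A B \<Phi> \<longleftrightarrow>
     (\<forall>a\<in>mm_carrier A. \<Phi> a \<in> mm_carrier B) \<and>
     (\<forall>a\<in>mm_carrier A. \<forall>a'\<in>mm_carrier A. \<Phi> (mm_add a a') = mm_add (\<Phi> a) (\<Phi> a')) \<and>
     (\<forall>c. \<forall>a\<in>mm_carrier A. \<Phi> (mm_smult c a) = mm_smult (h c) (\<Phi> a))"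

abbreviation linear_map :: "mm_alg \<Rightarrow> mm_alg \<Rightarrow> (mm \<Rightarrow> mm) \<Rightarrow> bool" where
  "linear_map \<equiv> semilinear_map (\<lambda>c. c)"

definition trace_preserving :: "mm_alg \<Rightarrow> (mm \<Rightarrow> mm) \<Rightarrow> bool" where
  "trace_preserving A \<Phi> \<longleftrightarrow> (\<forall>a\<in>mm_carrier A. mm_trace (\<Phi> a) = mm_trace a)"

definition star_isomorphism :: "mm_alg \<Rightarrow> mm_alg \<Rightarrow> (mm \<Rightarrow> mm) \<Rightarrow> bool" where
  "star_isomorphism A B \<Phi> \<longleftrightarrow>
     linear_map A B \<Phi> \<and> bij_betw \<Phi> (mm_carrier A) (mm_carrier B) \<and>
     (\<forall>a\<in>mm_carrier A. \<forall>a'\<in>mm_carrier A. \<Phi> (mm_mult a a') = mm_mult (\<Phi> a) (\<Phi> a')) \<and>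
     (\<forall>a\<in>mm_carrier A. \<Phi> (mm_dagger a) = mm_dagger (\<Phi> a))"

definition hs_adjoint :: "mm_alg \<Rightarrow> mm_alg \<Rightarrow> (mm \<Rightarrow> mm) \<Rightarrow> mm \<Rightarrow> mm" where
  "hs_adjoint A B \<Phi> b =
     (THE a'. a' \<in> mm_carrier A \<and> (\<forall>a\<in>mm_carrier A. mm_inner (\<Phi> a) b = mm_inner a a'))"


section \<open>Tensor products\<close>

text \<open>
  \<open>(\<Oplus>\<^sub>x M_{m_x}) \<otimes> (\<Oplus>\<^sub>y M_{n_y})\<close> is identified with \<open>\<Oplus>\<^sub>{(x,y)} M_{m_x n_y}\<close> by Kronecker products of blocks,
  the pairs \<open>(x,y)\<close> being enumerated as by \<^const>\<open>List.product\<close>.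
\<close>

definition kronecker :: "complex mat \<Rightarrow> complex mat \<Rightarrow> complex mat" where
  "kronecker M N = mat (dim_row M * dim_row N) (dim_col M * dim_col N)
     (\<lambda>(i, j). M $$ (i div dim_row N, j div dim_col N) * N $$ (i mod dim_row N, j mod dim_col N))"

definition alg_tensor :: "mm_alg \<Rightarrow> mm_alg \<Rightarrow> mm_alg" where
  "alg_tensor A B = map (\<lambda>(m, n). m * n) (List.product A B)"

definition mm_tensor :: "mm \<Rightarrow> mm \<Rightarrow> mm" where
  "mm_tensor a b = map (\<lambda>(M, N). kronecker M N) (List.product a b)"

text \<open>
  The unique (conjugate-)linear map on \<open>A \<otimes> B\<close> with \<open>a \<otimes> b \<mapsto> f a b\<close>. Membership in \<^const>\<open>extensional\<close>
  fixes the irrelevant values off the carrier, so that uniqueness holds.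
\<close>

definition tensor_lift ::
  "(complex \<Rightarrow> complex) \<Rightarrow> mm_alg \<Rightarrow> mm_alg \<Rightarrow> mm_alg \<Rightarrow> (mm \<Rightarrow> mm \<Rightarrow> mm) \<Rightarrow> mm \<Rightarrow> mm" where
  "tensor_lift h A B C f =
     (THE L. L \<in> extensional (mm_carrier (alg_tensor A B)) \<and>
             semilinear_map h (alg_tensor A B) C L \<and>
             (\<forall>a\<in>mm_carrier A. \<forall>b\<in>mm_carrier B. L (mm_tensor a b) = f a b))"

text \<open>\<open>\<Phi> \<otimes> \<Psi> : A \<otimes> B \<rightarrow> A' \<otimes> B'\<close> for \<open>\<Phi> : A \<rightarrow> A'\<close> and \<open>\<Psi> : B \<rightarrow> B'\<close>\<close>

definition map_tensor ::
  "mm_alg \<Rightarrow> mm_alg \<Rightarrow> mm_alg \<Rightarrow> mm_alg \<Rightarrow> (mm \<Rightarrow> mm) \<Rightarrow> (mm \<Rightarrow> mm) \<Rightarrow> mm \<Rightarrow> mm" where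
  "map_tensor A B A' B' \<Phi> \<Psi> =
     tensor_lift (\<lambda>c. c) A B (alg_tensor A' B') (\<lambda>a b. mm_tensor (\<Phi> a) (\<Psi> b))"

definition mult_map :: "mm_alg \<Rightarrow> mm \<Rightarrow> mm" where
  "mult_map A = tensor_lift (\<lambda>c. c) A A A mm_mult"

definition swap_dagger :: "mm_alg \<Rightarrow> mm_alg \<Rightarrow> mm \<Rightarrow> mm" where
  "swap_dagger B A =
     tensor_lift cnj B A (alg_tensor A B) (\<lambda>b a. mm_tensor (mm_dagger a) (mm_dagger b))"

definition completely_positive :: "mm_alg \<Rightarrow> mm_alg \<Rightarrow> (mm \<Rightarrow> mm) \<Rightarrow> bool" where
  "completely_positive A B \<Phi> \<longleftrightarrow>
     linear_map A B \<Phi> \<and>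
     (\<forall>n>0. \<forall>t\<in>mm_carrier (alg_tensor [n] A). mm_positive (alg_tensor [n] A) t \<longrightarrow>
        mm_positive (alg_tensor [n] B) (map_tensor [n] A [n] B (\<lambda>a. a) \<Phi> t))"

definition cptp :: "mm_alg \<Rightarrow> mm_alg \<Rightarrow> (mm \<Rightarrow> mm) \<Rightarrow> bool" where
  "cptp A B \<Phi> \<longleftrightarrow> completely_positive A B \<Phi> \<and> trace_preserving A \<Phi>"


section \<open>States over time and Bayes maps\<close>

definition channel_state :: "mm_alg \<Rightarrow> mm_alg \<Rightarrow> (mm \<Rightarrow> mm) \<Rightarrow> mm" where
  "channel_state A B \<Phi> =
     map_tensor A A A B (\<lambda>a. a) \<Phi> (hs_adjoint (alg_tensor A A) A (mult_map A) (mm_one A))"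

text \<open>\<open>\<Theta> A \<rho>\<close> is the map \<open>\<Theta>\<^sub>\<rho> : A \<rightarrow> A\<close>.\<close>

definition state_rendering :: "(mm_alg \<Rightarrow> mm \<Rightarrow> mm \<Rightarrow> mm) \<Rightarrow> bool" where
  "state_rendering \<Theta> \<longleftrightarrow>
     (\<forall>A \<rho>. multi_matrix A \<longrightarrow> \<rho> \<in> mm_states A \<longrightarrow> linear_map A A (\<Theta> A \<rho>)) \<and>
     (\<forall>A \<rho>. multi_matrix A \<longrightarrow> \<rho> \<in> mm_states A \<longrightarrow>
        (\<forall>a\<in>mm_carrier A. mm_mult \<rho> a = mm_mult a \<rho> \<longrightarrow> \<Theta> A \<rho> a = mm_mult \<rho> a)) \<and>
     (\<forall>A B \<E> \<rho>. multi_matrix A \<longrightarrow> multi_matrix B \<longrightarrow> \<rho> \<in> mm_states A \<longrightarrow> star_isomorphism A B \<E> \<longrightarrow>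
        (\<forall>b\<in>mm_carrier B. \<Theta> A \<rho> (inv_into (mm_carrier A) \<E> b)
                        = inv_into (mm_carrier A) \<E> (\<Theta> B (\<E> \<rho>) b))) \<and>
     (\<forall>A A' \<rho> \<rho>'. multi_matrix A \<longrightarrow> multi_matrix A' \<longrightarrow> \<rho> \<in> mm_states A \<longrightarrow> \<rho>' \<in> mm_states A' \<longrightarrow>
        \<rho> \<in> mm_center A \<or> \<rho>' \<in> mm_center A' \<longrightarrow>
        (\<forall>t\<in>mm_carrier (alg_tensor A A').
           \<Theta> (alg_tensor A A') (mm_tensor \<rho> \<rho>') t = map_tensor A A' A A' (\<Theta> A \<rho>) (\<Theta> A' \<rho>') t)) \<and>
     (\<forall>A \<rho>. multi_matrix A \<longrightarrow> \<rho> \<in> mm_states A \<longrightarrow>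
        (\<forall>a\<in>mm_carrier A. \<forall>b\<in>mm_carrier A. mm_inner (\<Theta> A \<rho> a) b = mm_inner a (\<Theta> A \<rho> b)) \<and>
        (\<forall>a\<in>mm_carrier A. Im (mm_inner a (\<Theta> A \<rho> a)) = 0 \<and> 0 \<le> Re (mm_inner a (\<Theta> A \<rho> a))))"

definition state_over_time ::
  "(mm_alg \<Rightarrow> mm \<Rightarrow> mm \<Rightarrow> mm) \<Rightarrow> mm_alg \<Rightarrow> mm_alg \<Rightarrow> (mm \<Rightarrow> mm) \<Rightarrow> mm \<Rightarrow> mm" where
  "state_over_time \<Theta> A B \<Phi> \<sigma> = map_tensor A B A B (\<Theta> A \<sigma>) (\<lambda>b. b) (channel_state A B \<Phi>)"

definition tilde_map :: "(mm \<Rightarrow> mm) \<Rightarrow> mm \<Rightarrow> mm" where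
  "tilde_map F b = mm_dagger (F (mm_dagger b))"

definition bayes_equation ::
  "(mm_alg \<Rightarrow> mm \<Rightarrow> mm \<Rightarrow> mm) \<Rightarrow> mm_alg \<Rightarrow> mm_alg \<Rightarrow> (mm \<Rightarrow> mm) \<Rightarrow> mm \<Rightarrow> (mm \<Rightarrow> mm) \<Rightarrow> bool" where
  "bayes_equation \<Theta> A B \<E> \<rho> F \<longleftrightarrow>
     state_over_time \<Theta> A B \<E> \<rho> = swap_dagger B A (state_over_time \<Theta> B A (tilde_map F) (\<E> \<rho>))"

definition bayes_map ::
  "(mm_alg \<Rightarrow> mm \<Rightarrow> mm \<Rightarrow> mm) \<Rightarrow> mm_alg \<Rightarrow> mm_alg \<Rightarrow> (mm \<Rightarrow> mm) \<Rightarrow> mm \<Rightarrow> (mm \<Rightarrow> mm) \<Rightarrow> bool" where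
  "bayes_map \<Theta> A B \<E> \<rho> F \<longleftrightarrow>
     linear_map B A F \<and> trace_preserving B F \<and> bayes_equation \<Theta> A B \<E> \<rho> F"

text \<open>
  The intertwining equation determines a generalized conditional expectation only up to the kernel of
  \<open>\<Theta>\<^sub>\<E>\<^sub>(\<^sub>\<rho>\<^sub>)\<close>; in particular it does not force \<open>G 1 = 1\<close>, and unitality is not part of this definition.
\<close>

definition gen_cond_expectation ::
  "(mm_alg \<Rightarrow> mm \<Rightarrow> mm \<Rightarrow> mm) \<Rightarrow> mm_alg \<Rightarrow> mm_alg \<Rightarrow> (mm \<Rightarrow> mm) \<Rightarrow> mm \<Rightarrow> (mm \<Rightarrow> mm) \<Rightarrow> bool" where
  "gen_cond_expectation \<Theta> A B \<E> \<rho> G \<longleftrightarrow>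
     linear_map A B G \<and> (\<forall>a\<in>mm_carrier A. \<E> (\<Theta> A \<rho> a) = \<Theta> B (\<E> \<rho>) (G a))"

end

theory Submission
  imports Defs
begin

text \<open>
  In matrix units \<open>e\<^sub>p\<close> of \<open>A\<close> and \<open>f\<^sub>q\<close> of \<open>B\<close> the channel state is \<open>D[\<Phi>] = \<Sum>\<^sub>p e\<^sub>p \<otimes> \<Phi>(e\<^sub>p\<^sup>\<dagger>)\<close>. With \<open>F\<close> the
  adjoint of \<open>G\<close> the Bayes equation thus reads
  \<open>\<Sum>\<^sub>p \<Theta>\<^sub>\<rho>(e\<^sub>p) \<otimes> \<E>(e\<^sub>p\<^sup>\<dagger>) = \<Sum>\<^sub>q F(f\<^sub>q) \<otimes> \<Theta>\<^sub>\<sigma>(f\<^sub>q)\<^sup>\<dagger>\<close> where \<open>\<sigma> = \<E>(\<rho>)\<close>. Contracting the first factor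
  with \<open>a\<close> turns the left side into \<open>\<E>(\<Theta>\<^sub>\<rho>(a)\<^sup>\<dagger>)\<close>, as \<open>\<Theta>\<^sub>\<rho>\<close> is self-adjoint, and the right side into
  \<open>\<Theta>\<^sub>\<sigma>(G(a))\<^sup>\<dagger>\<close>. They agree because the positive map \<open>\<E>\<close> commutes with the dagger. The adjoint of \<open>G\<close>
  preserves the trace iff \<open>G\<close> preserves the unit, as \<open>tr b = \<langle>1, b\<rangle>\<close>.
\<close>

section \<open>Coordinates\<close>

text \<open>Triples of block number, row and column label the matrix units of the algebra.
  Flattening all blocks into one finite index set turns identities between elements into identities
  between finite sums.\<close>

definition mm_idx :: "mm_alg \<Rightarrow> (nat \<times> nat \<times> nat) set" where
  "mm_idx A = (SIGMA x:{..<length A}. {..<A ! x} \<times> {..<A ! x})"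

definition mm_coord :: "mm \<Rightarrow> nat \<times> nat \<times> nat \<Rightarrow> complex" where
  "mm_coord a = (\<lambda>(x, i, j). (a ! x) $$ (i, j))"

definition mm_of :: "mm_alg \<Rightarrow> (nat \<times> nat \<times> nat \<Rightarrow> complex) \<Rightarrow> mm" where
  "mm_of A f = map (\<lambda>x. mat (A ! x) (A ! x) (\<lambda>(i, j). f (x, i, j))) [0..<length A]"

definition mm_unit :: "mm_alg \<Rightarrow> nat \<times> nat \<times> nat \<Rightarrow> mm" where
  "mm_unit A p = mm_of A (\<lambda>q. if q = p then 1 else 0)"

text \<open>The dagger sends the matrix unit at \<open>p\<close> to the one at
  \<open>flip_idx p\<close>; the fixed points are the diagonal positions.\<close>

definition flip_idx :: "nat \<times> nat \<times> nat \<Rightarrow> nat \<times> nat \<times> nat" where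
  "flip_idx = (\<lambda>(x, i, j). (x, j, i))"

lemma finite_mm_idx [simp]: "finite (mm_idx A)"
  by (simp add: mm_idx_def)

lemma sum_mm_idx:
  "sum f (mm_idx A) = (\<Sum>x<length A. \<Sum>i<A ! x. \<Sum>j<A ! x. f (x, i, j))"
  by (simp add: mm_idx_def sum.Sigma sum.cartesian_product split_def)

lemma mm_eqI:
  assumes "a \<in> mm_carrier A" "b \<in> mm_carrier A"
    and "\<And>p. p \<in> mm_idx A \<Longrightarrow> mm_coord a p = mm_coord b p"
  shows "a = b"
proof (rule nth_equalityI)
  show "length a = length b" using assms by (simp add: mm_carrier_def)
  fix x assume "x < length a"
  then have x: "x < length A" using assms by (simp add: mm_carrier_def)
  then have c: "a ! x \<in> carrier_mat (A ! x) (A ! x)" "b ! x \<in> carrier_mat (A ! x) (A ! x)"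
    using assms by (auto simp: mm_carrier_def)
  show "a ! x = b ! x"
  proof (rule eq_matI)
    fix i j assume "i < dim_row (b ! x)" "j < dim_col (b ! x)"
    then have "(x, i, j) \<in> mm_idx A" using x c by (auto simp: mm_idx_def)
    from assms(3) [OF this] show "(a ! x) $$ (i, j) = (b ! x) $$ (i, j)"
      by (simp add: mm_coord_def)
  qed (use c in auto)
qed

lemma mm_of_carrier [simp]: "mm_of A f \<in> mm_carrier A"
  by (simp add: mm_of_def mm_carrier_def)

lemma mm_coord_of [simp]: "p \<in> mm_idx A \<Longrightarrow> mm_coord (mm_of A f) p = f p"
  by (auto simp: mm_of_def mm_coord_def mm_idx_def)

lemma mm_unit_carrier [simp]: "mm_unit A p \<in> mm_carrier A"
  by (simp add: mm_unit_def)

lemma mm_coord_unit [simp]: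
  "q \<in> mm_idx A \<Longrightarrow> mm_coord (mm_unit A p) q = (if q = p then 1 else 0)"
  by (simp add: mm_unit_def)

lemma flip_idx_mem [simp]: "flip_idx p \<in> mm_idx A \<longleftrightarrow> p \<in> mm_idx A"
  by (auto simp: flip_idx_def mm_idx_def split: prod.splits)

lemma flip_idx_flip [simp]: "flip_idx (flip_idx p) = p"
  by (auto simp: flip_idx_def split: prod.splits)

lemma flip_idx_eq: "flip_idx p = q \<longleftrightarrow> p = flip_idx q"
  by (auto simp: flip_idx_def split: prod.splits)

lemma sum_flip_idx: "(\<Sum>p\<in>mm_idx A. f (flip_idx p)) = sum f (mm_idx A)"
  by (rule sum.reindex_bij_witness [of _ flip_idx flip_idx]) auto

section \<open>Entries of sums, multiples, adjoints and products\<close>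

lemma mm_carrierD:
  "a \<in> mm_carrier A \<Longrightarrow> length a = length A"
  "a \<in> mm_carrier A \<Longrightarrow> x < length A \<Longrightarrow> a ! x \<in> carrier_mat (A ! x) (A ! x)"
  by (auto simp: mm_carrier_def)

lemma mm_add_carrier [simp]:
  "a \<in> mm_carrier A \<Longrightarrow> b \<in> mm_carrier A \<Longrightarrow> mm_add a b \<in> mm_carrier A"
  by (simp add: mm_carrier_def mm_add_def)

lemma mm_coord_add [simp]:
  assumes "p \<in> mm_idx A" "a \<in> mm_carrier A" "b \<in> mm_carrier A"
  shows "mm_coord (mm_add a b) p = mm_coord a p + mm_coord b p"
  using assms mm_carrierD [OF assms(2)] mm_carrierD [OF assms(3)]
  by (fastforce simp: mm_add_def mm_coord_def mm_idx_def)

lemma mm_smult_carrier [simp]: "a \<in> mm_carrier A \<Longrightarrow> mm_smult c a \<in> mm_carrier A"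
  by (simp add: mm_carrier_def mm_smult_def)

lemma mm_coord_smult [simp]:
  assumes "p \<in> mm_idx A" "a \<in> mm_carrier A"
  shows "mm_coord (mm_smult c a) p = c * mm_coord a p"
  using assms mm_carrierD [OF assms(2)]
  by (fastforce simp: mm_smult_def mm_coord_def mm_idx_def)

lemma mat_adjoint_carrier:
  "M \<in> carrier_mat m n \<Longrightarrow> mat_adjoint M \<in> carrier_mat n m"
  unfolding mat_adjoint_def by (rule carrier_matI) auto

lemma mat_adjoint_index:
  fixes M :: "complex mat"
  assumes "M \<in> carrier_mat m n" "i < n" "j < m"
  shows "mat_adjoint M $$ (i, j) = cnj (M $$ (j, i))"
  using assms by (auto simp: mat_adjoint_def mat_of_rows_index)

lemma mm_dagger_carrier [simp]: "a \<in> mm_carrier A \<Longrightarrow> mm_dagger a \<in> mm_carrier A"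
  by (auto simp: mm_carrier_def mm_dagger_def mat_adjoint_carrier)

lemma mm_coord_dagger [simp]:
  assumes "p \<in> mm_idx A" "a \<in> mm_carrier A"
  shows "mm_coord (mm_dagger a) p = cnj (mm_coord a (flip_idx p))"
  using assms mm_carrierD [OF assms(2)]
  by (auto simp: mm_dagger_def mm_coord_def mm_idx_def flip_idx_def
      intro!: mat_adjoint_index [of _ "A ! fst p" "A ! fst p"])

lemma mm_one_carrier [simp]: "mm_one A \<in> mm_carrier A"
  by (simp add: mm_carrier_def mm_one_def)

lemma mm_coord_one:
  assumes "p \<in> mm_idx A"
  shows "mm_coord (mm_one A) p = (if flip_idx p = p then 1 else 0)"
  using assms by (auto simp: mm_one_def mm_coord_def mm_idx_def flip_idx_def split: if_splits)

lemma mm_mult_carrier [simp]: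
  "a \<in> mm_carrier A \<Longrightarrow> b \<in> mm_carrier A \<Longrightarrow> mm_mult a b \<in> mm_carrier A"
  by (fastforce simp: mm_carrier_def mm_mult_def)

lemma mm_coord_mult:
  assumes "a \<in> mm_carrier A" "b \<in> mm_carrier A" "(x, i, j) \<in> mm_idx A"
  shows "mm_coord (mm_mult a b) (x, i, j) =
    (\<Sum>k<A ! x. mm_coord a (x, i, k) * mm_coord b (x, k, j))"
proof -
  have "a ! x \<in> carrier_mat (A ! x) (A ! x)" "b ! x \<in> carrier_mat (A ! x) (A ! x)"
    using assms by (auto simp: mm_idx_def intro: mm_carrierD)
  then show ?thesis using assms mm_carrierD(1) [OF assms(1)] mm_carrierD(1) [OF assms(2)]
    by (auto simp: mm_mult_def mm_coord_def mm_idx_def scalar_prod_def atLeast0LessThan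
        intro!: sum.cong)
qed

section \<open>Trace and Hilbert-Schmidt inner product in coordinates\<close>

lemma mm_trace_coord:
  assumes "a \<in> mm_carrier A"
  shows "mm_trace a = (\<Sum>x<length A. \<Sum>i<A ! x. mm_coord a (x, i, i))"
proof -
  have "mm_trace a = (\<Sum>x<length A. sum_list (diag_mat (a ! x)))"
    using mm_carrierD(1) [OF assms]
    by (simp add: mm_trace_def sum_list_sum_nth atLeast0LessThan)
  also have "\<dots> = (\<Sum>x<length A. \<Sum>i<A ! x. mm_coord a (x, i, i))"
  proof (rule sum.cong)
    fix x assume "x \<in> {..<length A}"
    then have "dim_row (a ! x) = A ! x" using mm_carrierD(2) [OF assms] by auto
    then show "sum_list (diag_mat (a ! x)) = (\<Sum>i<A ! x. mm_coord a (x, i, i))"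
      by (simp add: diag_mat_def sum_list_sum_nth atLeast0LessThan mm_coord_def)
  qed simp
  finally show ?thesis .
qed

text \<open>This makes the matrix units an orthonormal basis: the Hilbert-Schmidt product is the
  standard inner product of the coordinate vectors.\<close>

lemma mm_inner_coord:
  assumes "a \<in> mm_carrier A" "b \<in> mm_carrier A"
  shows "mm_inner a b = (\<Sum>p\<in>mm_idx A. cnj (mm_coord a p) * mm_coord b p)"
proof -
  note d = mm_dagger_carrier [OF assms(1)]
  have "mm_coord (mm_mult (mm_dagger a) b) (x, i, i) =
      (\<Sum>k<A ! x. cnj (mm_coord a (x, k, i)) * mm_coord b (x, k, i))"
    if "x < length A" "i < A ! x" for x i
  proof -
    have "mm_coord (mm_dagger a) (x, i, k) = cnj (mm_coord a (x, k, i))" if "k < A ! x" for k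
      using mm_coord_dagger [OF _ assms(1), of "(x, i, k)"] that \<open>x < length A\<close> \<open>i < A ! x\<close>
      by (simp add: mm_idx_def flip_idx_def)
    then show ?thesis
      using mm_coord_mult [OF d assms(2), of x i i] that by (simp add: mm_idx_def)
  qed
  then have "mm_inner a b = (\<Sum>x<length A. \<Sum>i<A ! x. \<Sum>k<A ! x.
      cnj (mm_coord a (x, k, i)) * mm_coord b (x, k, i))"
    by (simp add: mm_inner_def mm_trace_coord [OF mm_mult_carrier [OF d assms(2)]])
  \<comment> \<open>The trace has columns outside and rows inside, \<open>sum_mm_idx\<close> the
    other way round.\<close>
  also have "\<dots> = (\<Sum>p\<in>mm_idx A. cnj (mm_coord a p) * mm_coord b p)"
    unfolding sum_mm_idx by (rule sum.cong [OF refl], rule sum.swap)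
  finally show ?thesis .
qed

text \<open>Writing the trace as pairing with the unit is what later turns trace preservation of an
  adjoint into a statement about the image of the unit.\<close>

lemma mm_trace_inner_one: "a \<in> mm_carrier A \<Longrightarrow> mm_trace a = mm_inner (mm_one A) a"
proof -
  assume a: "a \<in> mm_carrier A"
  have "(\<Sum>j<A ! x. cnj (mm_coord (mm_one A) (x, i, j)) * mm_coord a (x, i, j)) = mm_coord a (x, i, i)"
    if "x < length A" "i < A ! x" for x i
  proof -
    have "(\<Sum>j<A ! x. cnj (mm_coord (mm_one A) (x, i, j)) * mm_coord a (x, i, j)) =
       (\<Sum>j<A ! x. if j = i then mm_coord a (x, i, j) else 0)"
      using that by (intro sum.cong) (auto simp: mm_idx_def mm_coord_one flip_idx_def)
    then show ?thesis using that by simp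
  qed
  then show ?thesis by (simp add: mm_inner_coord [OF mm_one_carrier a] mm_trace_coord [OF a] sum_mm_idx)
qed

lemma mm_inner_unit_left:
  assumes "a \<in> mm_carrier A" "p \<in> mm_idx A"
  shows "mm_inner (mm_unit A p) a = mm_coord a p"
proof -
  have "mm_inner (mm_unit A p) a = (\<Sum>q\<in>mm_idx A. cnj (mm_coord (mm_unit A p) q) * mm_coord a q)"
    by (rule mm_inner_coord [OF mm_unit_carrier assms(1)])
  also have "\<dots> = (\<Sum>q\<in>mm_idx A. if q = p then mm_coord a q else 0)"
    by (rule sum.cong) auto
  finally show ?thesis using assms by simp
qed

lemma mm_inner_commute:
  "a \<in> mm_carrier A \<Longrightarrow> b \<in> mm_carrier A \<Longrightarrow> mm_inner a b = cnj (mm_inner b a)"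
  by (simp add: mm_inner_coord mult.commute)

lemma mm_inner_unit_right:
  "a \<in> mm_carrier A \<Longrightarrow> p \<in> mm_idx A \<Longrightarrow> mm_inner a (mm_unit A p) = cnj (mm_coord a p)"
  by (metis mm_inner_commute mm_inner_unit_left mm_unit_carrier)

lemma mm_dagger_dagger: "a \<in> mm_carrier A \<Longrightarrow> mm_dagger (mm_dagger a) = a"
  by (rule mm_eqI [of _ A]) (simp_all add: mm_coord_dagger [where A = A])

lemma mm_dagger_unit: "mm_dagger (mm_unit A p) = mm_unit A (flip_idx p)"
  by (rule mm_eqI [of _ A]) (simp_all add: mm_coord_dagger [where A = A] flip_idx_eq)

text \<open>The left side is the conjugate of tr(ab), and tr(ab) pairs the dagger of
  \<open>a\<close> with \<open>b\<close>. For matrix units this gives the entries of the adjoint of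
  multiplication at the unit.\<close>

lemma mm_inner_mult_one:
  assumes "a \<in> mm_carrier A" "b \<in> mm_carrier A"
  shows "mm_inner (mm_mult a b) (mm_one A) = mm_inner b (mm_dagger a)"
proof -
  have "mm_inner (mm_mult a b) (mm_one A) = cnj (mm_trace (mm_mult a b))"
    using assms by (metis mm_inner_commute mm_mult_carrier mm_one_carrier mm_trace_inner_one)
  also have "mm_trace (mm_mult a b) = mm_inner (mm_dagger a) b"
    by (simp add: mm_inner_def mm_dagger_dagger [OF assms(1)])
  also have "cnj \<dots> = mm_inner b (mm_dagger a)"
    using assms by (metis mm_dagger_carrier mm_inner_commute)
  finally show ?thesis .
qed


section \<open>Semilinear maps\<close>

lemma semilinear_mapD:
  assumes "semilinear_map h A B \<Phi>"
  shows "a \<in> mm_carrier A \<Longrightarrow> \<Phi> a \<in> mm_carrier B"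
    and "a \<in> mm_carrier A \<Longrightarrow> a' \<in> mm_carrier A \<Longrightarrow> \<Phi> (mm_add a a') = mm_add (\<Phi> a) (\<Phi> a')"
    and "a \<in> mm_carrier A \<Longrightarrow> \<Phi> (mm_smult c a) = mm_smult (h c) (\<Phi> a)"
  using assms by (auto simp: semilinear_map_def)

text \<open>A semilinear map is determined by its values on matrix units. The expansion is stated
  for one coordinate at a time, where the summands are complex numbers; \<open>h\<close> covers the
  linear and the conjugate-linear case together.\<close>

lemma semilinear_expand:
  assumes L: "semilinear_map h A B \<Phi>" and h: "h 0 = 0"
    and a: "a \<in> mm_carrier A" and q: "q \<in> mm_idx B"
  shows "mm_coord (\<Phi> a) q = (\<Sum>p\<in>mm_idx A. h (mm_coord a p) * mm_coord (\<Phi> (mm_unit A p)) q)"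
proof -
  \<comment> \<open>\<open>part S\<close> keeps the entries of \<open>a\<close> at positions in
    \<open>S\<close> and is zero elsewhere, so induction on \<open>S\<close> adds one matrix unit at
    a time and ends at \<open>a\<close>.\<close>
  define part where "part S = mm_of A (\<lambda>p. if p \<in> S then mm_coord a p else 0)" for S
  have *: "mm_coord (\<Phi> (part S)) q = (\<Sum>p\<in>S. h (mm_coord a p) * mm_coord (\<Phi> (mm_unit A p)) q)"
    if "finite S" "S \<subseteq> mm_idx A" for S
    using that
  proof (induction S rule: finite_induct)
    case empty
    \<comment> \<open>Semilinearity speaks of sums and multiples only; that zero goes to zero
      follows because zero is its own multiple by 0.\<close>
    have "part {} = mm_smult 0 (part {})"
      by (rule mm_eqI [of _ A]) (auto simp: part_def)
    then have "\<Phi> (part {}) = mm_smult 0 (\<Phi> (part {}))"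
      using semilinear_mapD(3) [OF L, of "part {}" 0] by (simp add: part_def h)
    moreover have "\<Phi> (part {}) \<in> mm_carrier B"
      by (simp add: part_def semilinear_mapD(1) [OF L])
    ultimately have "mm_coord (\<Phi> (part {})) q = 0 * mm_coord (\<Phi> (part {})) q"
      using mm_coord_smult [OF q, of "\<Phi> (part {})" 0] by simp
    then show ?case by simp
  next
    case (insert p S)
    have "part (insert p S) = mm_add (mm_smult (mm_coord a p) (mm_unit A p)) (part S)"
      by (rule mm_eqI [of _ A]) (use insert.hyps in \<open>auto simp: part_def\<close>)
    then have "\<Phi> (part (insert p S)) = mm_add (mm_smult (h (mm_coord a p)) (\<Phi> (mm_unit A p))) (\<Phi> (part S))"
      by (simp add: semilinear_mapD [OF L] part_def)
    moreover have "\<Phi> (mm_unit A p) \<in> mm_carrier B" "\<Phi> (part S) \<in> mm_carrier B"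
      by (auto simp: part_def intro: semilinear_mapD(1) [OF L])
    ultimately show ?case using insert q by simp
  qed
  have "part (mm_idx A) = a"
    by (rule mm_eqI [of _ A]) (auto simp: part_def a)
  with * [of "mm_idx A"] show ?thesis by simp
qed

section \<open>The Hilbert-Schmidt adjoint\<close>

lemma hs_adjoint_unique:
  assumes L: "linear_map A B \<Phi>" and b: "b \<in> mm_carrier B"
  shows "\<exists>!a'. a' \<in> mm_carrier A \<and> (\<forall>a\<in>mm_carrier A. mm_inner (\<Phi> a) b = mm_inner a a')"
proof (rule ex_ex1I)
  \<comment> \<open>Testing the defining equation at \<open>a = mm_unit A p\<close> forces the
    coordinate at \<open>p\<close>; these forced values are the witness.\<close>
  let ?a = "mm_of A (\<lambda>p. mm_inner (\<Phi> (mm_unit A p)) b)"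
  have "mm_inner (\<Phi> a) b = mm_inner a ?a" if a: "a \<in> mm_carrier A" for a
  proof -
    have "mm_inner (\<Phi> a) b = (\<Sum>q\<in>mm_idx B. \<Sum>p\<in>mm_idx A.
        cnj (mm_coord a p) * (cnj (mm_coord (\<Phi> (mm_unit A p)) q) * mm_coord b q))"
      using semilinear_expand [OF L refl a]
      by (simp add: mm_inner_coord [OF semilinear_mapD(1) [OF L a] b] sum_distrib_right mult.assoc)
    also have "\<dots> = mm_inner a ?a"
      by (subst sum.swap)
        (simp add: mm_inner_coord [OF a mm_of_carrier] sum_distrib_left
          mm_inner_coord [OF semilinear_mapD(1) [OF L mm_unit_carrier] b])
    finally show ?thesis .
  qed
  then show "\<exists>a'. a' \<in> mm_carrier A \<and> (\<forall>a\<in>mm_carrier A. mm_inner (\<Phi> a) b = mm_inner a a')"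
    using mm_of_carrier by blast
next
  fix a' a'' 
  assume "a' \<in> mm_carrier A \<and> (\<forall>a\<in>mm_carrier A. mm_inner (\<Phi> a) b = mm_inner a a')"
    and "a'' \<in> mm_carrier A \<and> (\<forall>a\<in>mm_carrier A. mm_inner (\<Phi> a) b = mm_inner a a'')"
  \<comment> \<open>Pairing with the matrix units reads off every coordinate.\<close>
  then show "a' = a''"
    by (intro mm_eqI [of _ A]) (auto simp: mm_inner_unit_left [symmetric])
qed

lemma
  assumes "linear_map A B \<Phi>" and "b \<in> mm_carrier B"
  shows hs_adjoint_carrier: "hs_adjoint A B \<Phi> b \<in> mm_carrier A"
    and hs_adjoint_inner: "a \<in> mm_carrier A \<Longrightarrow> mm_inner a (hs_adjoint A B \<Phi> b) = mm_inner (\<Phi> a) b"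
  using theI' [OF hs_adjoint_unique [OF assms]] by (auto simp: hs_adjoint_def)

lemma mm_coord_hs_adjoint:
  assumes "linear_map A B \<Phi>" and "b \<in> mm_carrier B" and "p \<in> mm_idx A"
  shows "mm_coord (hs_adjoint A B \<Phi> b) p = mm_inner (\<Phi> (mm_unit A p)) b"
  by (metis assms hs_adjoint_carrier hs_adjoint_inner mm_inner_unit_left mm_unit_carrier)

lemma linear_map_hs_adjoint:
  assumes L: "linear_map A B \<Phi>"
  shows "linear_map B A (hs_adjoint A B \<Phi>)"
proof -
  have c: "\<Phi> (mm_unit A p) \<in> mm_carrier B" for p
    by (simp add: semilinear_mapD(1) [OF L])
  show ?thesis
    unfolding semilinear_map_def
  proof (intro conjI ballI allI)
    fix b b' assume b: "b \<in> mm_carrier B" "b' \<in> mm_carrier B"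
    show "hs_adjoint A B \<Phi> (mm_add b b') = mm_add (hs_adjoint A B \<Phi> b) (hs_adjoint A B \<Phi> b')"
      using b
      by (intro mm_eqI [of _ A])
        (auto simp: hs_adjoint_carrier [OF L] mm_coord_hs_adjoint [OF L] mm_inner_coord [OF c]
          algebra_simps sum.distrib)
  next
    fix z b assume b: "b \<in> mm_carrier B"
    show "hs_adjoint A B \<Phi> (mm_smult z b) = mm_smult z (hs_adjoint A B \<Phi> b)"
      using b
      by (intro mm_eqI [of _ A])
        (auto simp: hs_adjoint_carrier [OF L] mm_coord_hs_adjoint [OF L] mm_inner_coord [OF c]
          algebra_simps sum_distrib_left)
  qed (simp add: hs_adjoint_carrier [OF L])
qed


section \<open>Tensor products\<close>

text \<open>The position of the tensor product of the matrix units at \<open>p\<close> and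
  \<open>q\<close> in the Kronecker layout. Block, row and column are each two-digit numbers whose
  low digit comes from \<open>B\<close>, hence only the sizes in \<open>B\<close> enter.\<close>

definition tensor_idx :: "mm_alg \<Rightarrow> nat \<times> nat \<times> nat \<Rightarrow> nat \<times> nat \<times> nat \<Rightarrow> nat \<times> nat \<times> nat" where
  "tensor_idx B = (\<lambda>(x, i, j) (y, k, l). (x * length B + y, i * B ! y + k, j * B ! y + l))"

lemma less_mult_add:
  fixes i k m n :: nat
  assumes "i < m" "k < n"
  shows "i * n + k < m * n"
proof -
  have "i * n + k < Suc i * n" using assms by simp
  also have "\<dots> \<le> m * n" using assms by (intro mult_le_mono1) simp
  finally show ?thesis .
qed

lemma length_alg_tensor [simp]: "length (alg_tensor A B) = length A * length B"
  by (simp add: alg_tensor_def)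

lemma alg_tensor_nth:
  "z < length A * length B \<Longrightarrow> alg_tensor A B ! z = A ! (z div length B) * B ! (z mod length B)"
  by (simp add: alg_tensor_def product_nth)

lemma mult_add_div:
  fixes i k n :: nat
  shows "k < n \<Longrightarrow> (i * n + k) div n = i"
  by simp

lemma tensor_idx_mem [simp]:
  assumes "p \<in> mm_idx A" "q \<in> mm_idx B"
  shows "tensor_idx B p q \<in> mm_idx (alg_tensor A B)"
  using assms by (auto simp: mm_idx_def tensor_idx_def alg_tensor_nth less_mult_add mult_add_div)

lemma tensor_idx_cases:
  assumes "r \<in> mm_idx (alg_tensor A B)"
  obtains p q where "p \<in> mm_idx A" "q \<in> mm_idx B" "r = tensor_idx B p q"
proof -
  obtain z i j where r: "r = (z, i, j)" by (cases r)
  define x y where "x = z div length B" and "y = z mod length B"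
  have z: "z < length A * length B" and ij: "i < A ! x * B ! y" "j < A ! x * B ! y"
    using assms by (auto simp: r mm_idx_def alg_tensor_nth x_def y_def)
  \<comment> \<open>A number below a product forces the factors to be positive, so quotient and
    remainder recover the two digits.\<close>
  have "length B > 0" using z by (cases "length B") auto
  then have xy: "x < length A" "y < length B" 
    using z by (auto simp: x_def y_def less_mult_imp_div_less)
  have "B ! y > 0" using ij by (cases "B ! y") auto
  then have "(x, i div B ! y, j div B ! y) \<in> mm_idx A" "(y, i mod B ! y, j mod B ! y) \<in> mm_idx B"
    using xy ij by (auto simp: mm_idx_def less_mult_imp_div_less)
  moreover have "r = tensor_idx B (x, i div B ! y, j div B ! y) (y, i mod B ! y, j mod B ! y)"
    unfolding tensor_idx_def r prod.case div_mult_mod_eq by (simp add: x_def y_def)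
  ultimately show thesis using that by blast
qed

lemma mult_add_eq_iff:
  fixes i k n :: nat
  assumes "k < n" "k' < n"
  shows "i * n + k = i' * n + k' \<longleftrightarrow> i = i' \<and> k = k'"
proof
  assume eq: "i * n + k = i' * n + k'"
  have "(i * n + k) div n = i" "(i' * n + k') div n = i'" using assms by auto
  with eq show "i = i' \<and> k = k'" by auto
qed auto

lemma tensor_idx_eq_iff:
  assumes "q \<in> mm_idx B" "q' \<in> mm_idx B"
  shows "tensor_idx B p q = tensor_idx B p' q' \<longleftrightarrow> p = p' \<and> q = q'"
  using assms
  by (auto simp: mm_idx_def tensor_idx_def mult_add_eq_iff split: prod.splits)

lemma mm_tensor_carrier [simp]:
  assumes "a \<in> mm_carrier A" "b \<in> mm_carrier B"
  shows "mm_tensor a b \<in> mm_carrier (alg_tensor A B)"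
proof -
  have "kronecker (a ! (z div length B)) (b ! (z mod length B)) \<in>
      carrier_mat (A ! (z div length B) * B ! (z mod length B)) (A ! (z div length B) * B ! (z mod length B))"
    if "z < length A * length B" for z
  proof -
    have "length B > 0" using that by (cases "length B") auto
    then have "z div length B < length A" "z mod length B < length B"
      using that by (auto simp: less_mult_imp_div_less)
    then have "a ! (z div length B) \<in> carrier_mat (A ! (z div length B)) (A ! (z div length B))"
      "b ! (z mod length B) \<in> carrier_mat (B ! (z mod length B)) (B ! (z mod length B))"
      using assms mm_carrierD by blast+
    then show ?thesis by (auto simp: kronecker_def)
  qed
  then show ?thesis using mm_carrierD(1) [OF assms(1)] mm_carrierD(1) [OF assms(2)]
    by (simp add: mm_carrier_def mm_tensor_def product_nth alg_tensor_nth)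
qed

lemma mm_coord_tensor [simp]:
  assumes pq: "p \<in> mm_idx A" "q \<in> mm_idx B" and ab: "a \<in> mm_carrier A" "b \<in> mm_carrier B"
  shows "mm_coord (mm_tensor a b) (tensor_idx B p q) = mm_coord a p * mm_coord b q"
proof -
  obtain x i j y k l where eq: "p = (x, i, j)" "q = (y, k, l)" by (cases p, cases q)
  have lt: "x < length A" "i < A ! x" "j < A ! x" "y < length B" "k < B ! y" "l < B ! y"
    using pq by (auto simp: eq mm_idx_def)
  have "a ! x \<in> carrier_mat (A ! x) (A ! x)" "b ! y \<in> carrier_mat (B ! y) (B ! y)"
    using ab lt mm_carrierD by blast+
  then show ?thesis using lt mm_carrierD(1) [OF ab(1)] mm_carrierD(1) [OF ab(2)]
    by (auto simp: eq tensor_idx_def mm_coord_def mm_tensor_def product_nth less_mult_add mult_add_div kronecker_def)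
qed

section \<open>Universal property of the tensor product\<close>

lemma mm_tensor_unit:
  assumes "p \<in> mm_idx A" "q \<in> mm_idx B"
  shows "mm_tensor (mm_unit A p) (mm_unit B q) = mm_unit (alg_tensor A B) (tensor_idx B p q)"
  by (rule mm_eqI [of _ "alg_tensor A B"])
    (use assms in \<open>auto elim!: tensor_idx_cases simp: tensor_idx_eq_iff\<close>)

text \<open>Product tensors of matrix units are the matrix units of the tensor algebra, so a map
  with prescribed values on product tensors exists and is unique on the carrier; extensionality
  settles it elsewhere. The conditions on \<open>h\<close> hold for the identity and for
  \<open>cnj\<close>.\<close>

lemma tensor_lift_unique:
  assumes h: "\<And>u v. h (u + v) = h u + h v" "\<And>u v. h (u * v) = h u * h v"
    and f1: "\<And>b. b \<in> mm_carrier B \<Longrightarrow> semilinear_map h A C (\<lambda>a. f a b)"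
    and f2: "\<And>a. a \<in> mm_carrier A \<Longrightarrow> semilinear_map h B C (f a)"
  shows "\<exists>!L. L \<in> extensional (mm_carrier (alg_tensor A B)) \<and>
             semilinear_map h (alg_tensor A B) C L \<and>
             (\<forall>a\<in>mm_carrier A. \<forall>b\<in>mm_carrier B. L (mm_tensor a b) = f a b)"
proof (rule ex_ex1I)
  have h0: "h 0 = 0" using h(1) [of 0 0] by simp
  let ?D = "mm_carrier (alg_tensor A B)"
  \<comment> \<open>The only candidate: expand \<open>t\<close> in the matrix units and replace each
    product tensor by the value of \<open>f\<close>.\<close>
  let ?L = "restrict (\<lambda>t. mm_of C (\<lambda>r. \<Sum>p\<in>mm_idx A. \<Sum>q\<in>mm_idx B.
    h (mm_coord t (tensor_idx B p q)) * mm_coord (f (mm_unit A p) (mm_unit B q)) r)) ?D"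
  have "semilinear_map h (alg_tensor A B) C ?L"
    unfolding semilinear_map_def
    by (intro conjI ballI allI; (rule mm_eqI [of _ C])?)
      (simp_all add: mm_coord_add [where A = "alg_tensor A B"] mm_coord_smult [where A = "alg_tensor A B"]
        h sum.distrib algebra_simps sum_distrib_left)
  moreover have "?L (mm_tensor a b) = f a b" if a: "a \<in> mm_carrier A" and b: "b \<in> mm_carrier B" for a b
  proof (rule mm_eqI [of _ C])
    show "?L (mm_tensor a b) \<in> mm_carrier C" using a b by simp
    show "f a b \<in> mm_carrier C" by (rule semilinear_mapD(1) [OF f2 [OF a] b])
    fix r assume r: "r \<in> mm_idx C"
    have "mm_coord (f a b) r = (\<Sum>p\<in>mm_idx A. h (mm_coord a p) * mm_coord (f (mm_unit A p) b) r)"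
      by (rule semilinear_expand [OF f1 [OF b] h0 a r])
    also have "\<dots> = (\<Sum>p\<in>mm_idx A. h (mm_coord a p) *
        (\<Sum>q\<in>mm_idx B. h (mm_coord b q) * mm_coord (f (mm_unit A p) (mm_unit B q)) r))"
      by (simp add: semilinear_expand [OF f2 [OF mm_unit_carrier] h0 b r])
    also have "\<dots> = mm_coord (?L (mm_tensor a b)) r"
      using a b r by (simp add: h sum_distrib_left mult.assoc)
    finally show "mm_coord (?L (mm_tensor a b)) r = mm_coord (f a b) r" ..
  qed
  ultimately show "\<exists>L. L \<in> extensional ?D \<and> semilinear_map h (alg_tensor A B) C L \<and>
             (\<forall>a\<in>mm_carrier A. \<forall>b\<in>mm_carrier B. L (mm_tensor a b) = f a b)"
    by (intro exI [of _ ?L]) auto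
  fix L L'
  assume L: "L \<in> extensional ?D \<and> semilinear_map h (alg_tensor A B) C L \<and>
             (\<forall>a\<in>mm_carrier A. \<forall>b\<in>mm_carrier B. L (mm_tensor a b) = f a b)"
    and L': "L' \<in> extensional ?D \<and> semilinear_map h (alg_tensor A B) C L' \<and>
             (\<forall>a\<in>mm_carrier A. \<forall>b\<in>mm_carrier B. L' (mm_tensor a b) = f a b)"
  \<comment> \<open>Agreement on product tensors already covers a basis;
    \<open>semilinear_expand\<close> extends it to the whole carrier.\<close>
  have unit: "L (mm_unit (alg_tensor A B) r) = L' (mm_unit (alg_tensor A B) r)"
    if "r \<in> mm_idx (alg_tensor A B)" for r
    using that by (rule tensor_idx_cases) (metis L L' mm_tensor_unit mm_unit_carrier)
  show "L = L'"
  proof (rule extensionalityI [of _ ?D])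
    fix t assume t: "t \<in> ?D"
    show "L t = L' t"
    proof (rule mm_eqI [of _ C])
      fix r assume r: "r \<in> mm_idx C"
      show "mm_coord (L t) r = mm_coord (L' t) r"
        using semilinear_expand [of h _ C L, OF _ h0 t r] semilinear_expand [of h _ C L', OF _ h0 t r] L L' unit
        by simp
    qed (use L L' t in \<open>auto intro: semilinear_mapD(1)\<close>)
  qed (use L L' in auto)
qed

lemma
  assumes h: "\<And>u v. h (u + v) = h u + h v" "\<And>u v. h (u * v) = h u * h v"
    and f: "\<And>b. b \<in> mm_carrier B \<Longrightarrow> semilinear_map h A C (\<lambda>a. f a b)"
      "\<And>a. a \<in> mm_carrier A \<Longrightarrow> semilinear_map h B C (f a)"
  shows semilinear_tensor_lift: "semilinear_map h (alg_tensor A B) C (tensor_lift h A B C f)"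
    and tensor_lift_tensor: "a \<in> mm_carrier A \<Longrightarrow> b \<in> mm_carrier B \<Longrightarrow>
      tensor_lift h A B C f (mm_tensor a b) = f a b"
  using theI' [OF tensor_lift_unique [OF assms]] by (auto simp: tensor_lift_def)

lemma sum_tensor_idx:
  "sum g (mm_idx (alg_tensor A B)) = (\<Sum>p\<in>mm_idx A. \<Sum>q\<in>mm_idx B. g (tensor_idx B p q))"
proof -
  have inj: "inj_on (\<lambda>(p, q). tensor_idx B p q) (mm_idx A \<times> mm_idx B)"
    by (auto simp: inj_on_def tensor_idx_eq_iff)
  have img: "(\<lambda>(p, q). tensor_idx B p q) ` (mm_idx A \<times> mm_idx B) = mm_idx (alg_tensor A B)"
    by (auto simp: image_iff) (metis SigmaI tensor_idx_cases case_prod_conv)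
  show ?thesis
    unfolding img [symmetric] sum.reindex [OF inj]
    by (simp add: sum.cartesian_product split_def o_def)
qed

text \<open>The explicit formula behind the definite description. Entries of tensor products of maps
  and of the swap are computed from it.\<close>

lemma mm_coord_tensor_lift:
  assumes h: "\<And>u v. h (u + v) = h u + h v" "\<And>u v. h (u * v) = h u * h v"
    and f: "\<And>b. b \<in> mm_carrier B \<Longrightarrow> semilinear_map h A C (\<lambda>a. f a b)"
      "\<And>a. a \<in> mm_carrier A \<Longrightarrow> semilinear_map h B C (f a)"
    and t: "t \<in> mm_carrier (alg_tensor A B)" and r: "r \<in> mm_idx C"
  shows "mm_coord (tensor_lift h A B C f t) r = (\<Sum>p\<in>mm_idx A. \<Sum>q\<in>mm_idx B.
    h (mm_coord t (tensor_idx B p q)) * mm_coord (f (mm_unit A p) (mm_unit B q)) r)"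
proof -
  have h0: "h 0 = 0" using h(1) [of 0 0] by simp
  have L: "semilinear_map h (alg_tensor A B) C (tensor_lift h A B C f)"
    by (rule semilinear_tensor_lift) (use h f in auto)
  have "tensor_lift h A B C f (mm_tensor (mm_unit A p) (mm_unit B q)) = f (mm_unit A p) (mm_unit B q)" for p q
    by (rule tensor_lift_tensor) (use h f in auto)
  then show ?thesis
    by (simp add: semilinear_expand [OF L h0 t r] sum_tensor_idx mm_tensor_unit [symmetric])
qed

lemma mm_eqI_tensor:
  assumes "a \<in> mm_carrier (alg_tensor A B)" "b \<in> mm_carrier (alg_tensor A B)"
    and "\<And>p q. p \<in> mm_idx A \<Longrightarrow> q \<in> mm_idx B \<Longrightarrow>
      mm_coord a (tensor_idx B p q) = mm_coord b (tensor_idx B p q)"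
  shows "a = b"
  using assms(1,2) by (rule mm_eqI) (metis assms(3) tensor_idx_cases)

section \<open>Bilinearity and tensor products of maps\<close>

lemma mm_tensor_add_left:
  assumes "a \<in> mm_carrier A" "a' \<in> mm_carrier A" "b \<in> mm_carrier B"
  shows "mm_tensor (mm_add a a') b = mm_add (mm_tensor a b) (mm_tensor a' b)"
  by (rule mm_eqI_tensor [of _ A B])
    (use assms in \<open>simp_all add: mm_coord_add [where A = "alg_tensor A B"] algebra_simps\<close>)

lemma mm_tensor_add_right:
  assumes "a \<in> mm_carrier A" "b \<in> mm_carrier B" "b' \<in> mm_carrier B"
  shows "mm_tensor a (mm_add b b') = mm_add (mm_tensor a b) (mm_tensor a b')"
  by (rule mm_eqI_tensor [of _ A B])
    (use assms in \<open>simp_all add: mm_coord_add [where A = "alg_tensor A B"] algebra_simps\<close>)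

lemma mm_tensor_smult_left:
  assumes "a \<in> mm_carrier A" "b \<in> mm_carrier B"
  shows "mm_tensor (mm_smult c a) b = mm_smult c (mm_tensor a b)"
  by (rule mm_eqI_tensor [of _ A B])
    (use assms in \<open>simp_all add: mm_coord_smult [where A = "alg_tensor A B"]\<close>)

lemma mm_tensor_smult_right:
  assumes "a \<in> mm_carrier A" "b \<in> mm_carrier B"
  shows "mm_tensor a (mm_smult c b) = mm_smult c (mm_tensor a b)"
  by (rule mm_eqI_tensor [of _ A B])
    (use assms in \<open>simp_all add: mm_coord_smult [where A = "alg_tensor A B"]\<close>)

lemma semilinear_tensor_left:
  assumes "semilinear_map h A C \<Phi>" and "d \<in> mm_carrier D"
  shows "semilinear_map h A (alg_tensor C D) (\<lambda>a. mm_tensor (\<Phi> a) d)"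
  using assms
  by (simp add: semilinear_map_def mm_tensor_add_left [of _ C _ _ D] mm_tensor_smult_left [of _ C _ D])

lemma semilinear_tensor_right:
  assumes "semilinear_map h B D \<Psi>" and "c \<in> mm_carrier C"
  shows "semilinear_map h B (alg_tensor C D) (\<lambda>b. mm_tensor c (\<Psi> b))"
  using assms
  by (simp add: semilinear_map_def mm_tensor_add_right [of _ C _ D] mm_tensor_smult_right [of _ C _ D])

lemma
  assumes \<Phi>: "linear_map A A' \<Phi>" and \<Psi>: "linear_map B B' \<Psi>"
  shows linear_map_tensor: "linear_map (alg_tensor A B) (alg_tensor A' B') (map_tensor A B A' B' \<Phi> \<Psi>)"
    and map_tensor_tensor: "a \<in> mm_carrier A \<Longrightarrow> b \<in> mm_carrier B \<Longrightarrow>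
      map_tensor A B A' B' \<Phi> \<Psi> (mm_tensor a b) = mm_tensor (\<Phi> a) (\<Psi> b)"
    and mm_coord_map_tensor: "p \<in> mm_idx A' \<Longrightarrow> q \<in> mm_idx B' \<Longrightarrow> t \<in> mm_carrier (alg_tensor A B) \<Longrightarrow>
      mm_coord (map_tensor A B A' B' \<Phi> \<Psi> t) (tensor_idx B' p q) =
      (\<Sum>p'\<in>mm_idx A. \<Sum>q'\<in>mm_idx B. mm_coord t (tensor_idx B p' q') *
        (mm_coord (\<Phi> (mm_unit A p')) p * mm_coord (\<Psi> (mm_unit B q')) q))"
proof -
  have f: "linear_map A (alg_tensor A' B') (\<lambda>a. mm_tensor (\<Phi> a) (\<Psi> b))" if "b \<in> mm_carrier B" for b
    by (rule semilinear_tensor_left [OF \<Phi> semilinear_mapD(1) [OF \<Psi> that]])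
  have g: "linear_map B (alg_tensor A' B') (\<lambda>b. mm_tensor (\<Phi> a) (\<Psi> b))" if "a \<in> mm_carrier A" for a
    by (rule semilinear_tensor_right [OF \<Psi> semilinear_mapD(1) [OF \<Phi> that]])
  show "linear_map (alg_tensor A B) (alg_tensor A' B') (map_tensor A B A' B' \<Phi> \<Psi>)"
    unfolding map_tensor_def by (rule semilinear_tensor_lift) (use f g in auto)
  show "map_tensor A B A' B' \<Phi> \<Psi> (mm_tensor a b) = mm_tensor (\<Phi> a) (\<Psi> b)"
    if "a \<in> mm_carrier A" "b \<in> mm_carrier B"
    unfolding map_tensor_def by (rule tensor_lift_tensor) (use f g that in auto)
  assume pq: "p \<in> mm_idx A'" "q \<in> mm_idx B'" and t: "t \<in> mm_carrier (alg_tensor A B)"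
  have "mm_coord (map_tensor A B A' B' \<Phi> \<Psi> t) (tensor_idx B' p q) =
      (\<Sum>p'\<in>mm_idx A. \<Sum>q'\<in>mm_idx B. mm_coord t (tensor_idx B p' q') *
        mm_coord (mm_tensor (\<Phi> (mm_unit A p')) (\<Psi> (mm_unit B q'))) (tensor_idx B' p q))"
    unfolding map_tensor_def by (rule mm_coord_tensor_lift) (use f g t pq in auto)
  then show "mm_coord (map_tensor A B A' B' \<Phi> \<Psi> t) (tensor_idx B' p q) =
      (\<Sum>p'\<in>mm_idx A. \<Sum>q'\<in>mm_idx B. mm_coord t (tensor_idx B p' q') *
        (mm_coord (\<Phi> (mm_unit A p')) p * mm_coord (\<Psi> (mm_unit B q')) q))"
    by (simp add: mm_coord_tensor [OF pq] semilinear_mapD(1) [OF \<Phi>] semilinear_mapD(1) [OF \<Psi>])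
qed

section \<open>Multiplication map, conjugation and swap\<close>

lemma linear_mult_left:
  assumes b: "b \<in> mm_carrier A"
  shows "linear_map A A (\<lambda>a. mm_mult a b)"
  unfolding semilinear_map_def
proof (intro conjI ballI allI)
  fix a a' assume a: "a \<in> mm_carrier A" "a' \<in> mm_carrier A"
  show "mm_mult (mm_add a a') b = mm_add (mm_mult a b) (mm_mult a' b)"
  proof (rule mm_eqI [of _ A])
    fix p assume p: "p \<in> mm_idx A"
    obtain x i j where [simp]: "p = (x, i, j)" by (cases p)
    have "(x, i, k) \<in> mm_idx A" if "k < A ! x" for k
      using p that by (auto simp: mm_idx_def)
    then show "mm_coord (mm_mult (mm_add a a') b) p = mm_coord (mm_add (mm_mult a b) (mm_mult a' b)) p"
      using p a b by (simp add: mm_coord_mult [where A = A] mm_coord_add [where A = A] sum.distrib algebra_simps)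
  qed (use a b in auto)
next
  fix c a assume a: "a \<in> mm_carrier A"
  show "mm_mult (mm_smult c a) b = mm_smult c (mm_mult a b)"
  proof (rule mm_eqI [of _ A])
    fix p assume p: "p \<in> mm_idx A"
    obtain x i j where [simp]: "p = (x, i, j)" by (cases p)
    have "(x, i, k) \<in> mm_idx A" if "k < A ! x" for k
      using p that by (auto simp: mm_idx_def)
    then show "mm_coord (mm_mult (mm_smult c a) b) p = mm_coord (mm_smult c (mm_mult a b)) p"
      using p a b by (simp add: mm_coord_mult [where A = A] mm_coord_smult [where A = A] sum_distrib_left algebra_simps)
  qed (use a b in auto)
qed (use b in auto)

lemma linear_mult_right:
  assumes b: "b \<in> mm_carrier A"
  shows "linear_map A A (mm_mult b)"
  unfolding semilinear_map_def
proof (intro conjI ballI allI)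
  fix a a' assume a: "a \<in> mm_carrier A" "a' \<in> mm_carrier A"
  show "mm_mult b (mm_add a a') = mm_add (mm_mult b a) (mm_mult b a')"
  proof (rule mm_eqI [of _ A])
    fix p assume p: "p \<in> mm_idx A"
    obtain x i j where [simp]: "p = (x, i, j)" by (cases p)
    have "(x, k, j) \<in> mm_idx A" if "k < A ! x" for k
      using p that by (auto simp: mm_idx_def)
    then show "mm_coord (mm_mult b (mm_add a a')) p = mm_coord (mm_add (mm_mult b a) (mm_mult b a')) p"
      using p a b by (simp add: mm_coord_mult [where A = A] mm_coord_add [where A = A] sum.distrib algebra_simps)
  qed (use a b in auto)
next
  fix c a assume a: "a \<in> mm_carrier A"
  show "mm_mult b (mm_smult c a) = mm_smult c (mm_mult b a)"
  proof (rule mm_eqI [of _ A])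
    fix p assume p: "p \<in> mm_idx A"
    obtain x i j where [simp]: "p = (x, i, j)" by (cases p)
    have "(x, k, j) \<in> mm_idx A" if "k < A ! x" for k
      using p that by (auto simp: mm_idx_def)
    then show "mm_coord (mm_mult b (mm_smult c a)) p = mm_coord (mm_smult c (mm_mult b a)) p"
      using p a b by (simp add: mm_coord_mult [where A = A] mm_coord_smult [where A = A] sum_distrib_left algebra_simps)
  qed (use a b in auto)
qed (use b in auto)

lemma linear_mult_map: "linear_map (alg_tensor A A) A (mult_map A)"
  unfolding mult_map_def
  by (rule semilinear_tensor_lift) (auto intro: linear_mult_left linear_mult_right)

lemma mult_map_tensor:
  "a \<in> mm_carrier A \<Longrightarrow> b \<in> mm_carrier A \<Longrightarrow> mult_map A (mm_tensor a b) = mm_mult a b"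
  unfolding mult_map_def
  by (rule tensor_lift_tensor) (auto intro: linear_mult_left linear_mult_right)

lemma semilinear_dagger: "semilinear_map cnj A A mm_dagger"
  unfolding semilinear_map_def
  by (auto intro!: mm_eqI [of _ A]
      simp: mm_coord_dagger [where A = A] mm_coord_add [where A = A] mm_coord_smult [where A = A])

lemma
  shows semilinear_swap_dagger: "semilinear_map cnj (alg_tensor B A) (alg_tensor A B) (swap_dagger B A)"
    and mm_coord_swap_dagger: "p \<in> mm_idx A \<Longrightarrow> q \<in> mm_idx B \<Longrightarrow> t \<in> mm_carrier (alg_tensor B A) \<Longrightarrow>
      mm_coord (swap_dagger B A t) (tensor_idx B p q) = cnj (mm_coord t (tensor_idx A (flip_idx q) (flip_idx p)))"
proof -
  let ?f = "\<lambda>b a. mm_tensor (mm_dagger a) (mm_dagger b)"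
  have f: "semilinear_map cnj B (alg_tensor A B) (\<lambda>b. ?f b a)" if "a \<in> mm_carrier A" for a
    using that by (intro semilinear_tensor_right semilinear_dagger) simp
  have g: "semilinear_map cnj A (alg_tensor A B) (\<lambda>a. ?f b a)" if "b \<in> mm_carrier B" for b
    using that by (intro semilinear_tensor_left semilinear_dagger) simp
  show "semilinear_map cnj (alg_tensor B A) (alg_tensor A B) (swap_dagger B A)"
    unfolding swap_dagger_def by (rule semilinear_tensor_lift) (use f g in auto)
  assume pq: "p \<in> mm_idx A" "q \<in> mm_idx B" and t: "t \<in> mm_carrier (alg_tensor B A)"
  have "mm_coord (swap_dagger B A t) (tensor_idx B p q) =
      (\<Sum>q'\<in>mm_idx B. \<Sum>p'\<in>mm_idx A. cnj (mm_coord t (tensor_idx A q' p')) *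
        mm_coord (?f (mm_unit B q') (mm_unit A p')) (tensor_idx B p q))"
    unfolding swap_dagger_def by (rule mm_coord_tensor_lift) (use f g t pq in auto)
  \<comment> \<open>Daggers of matrix units are the flipped matrix units, so a single term of the
    double sum survives.\<close>
  also have "\<dots> = (\<Sum>q'\<in>mm_idx B. \<Sum>p'\<in>mm_idx A. if p' = flip_idx p then
      (if q' = flip_idx q then cnj (mm_coord t (tensor_idx A q' p')) else 0) else 0)"
    using pq by (intro sum.cong refl) (simp add: mm_dagger_unit flip_idx_eq)
  also have "\<dots> = cnj (mm_coord t (tensor_idx A (flip_idx q) (flip_idx p)))"
    using pq by simp
  finally show "mm_coord (swap_dagger B A t) (tensor_idx B p q) =
    cnj (mm_coord t (tensor_idx A (flip_idx q) (flip_idx p)))" .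
qed


section \<open>States over time\<close>

text \<open>In other words, the adjoint of multiplication sends the unit to the sum of all matrix
  units tensored with their daggers.\<close>

lemma mm_coord_hs_adjoint_mult_map_one:
  assumes "p \<in> mm_idx A" "q \<in> mm_idx A"
  shows "mm_coord (hs_adjoint (alg_tensor A A) A (mult_map A) (mm_one A)) (tensor_idx A p q) =
    (if q = flip_idx p then 1 else 0)"
proof -
  have "mm_coord (hs_adjoint (alg_tensor A A) A (mult_map A) (mm_one A)) (tensor_idx A p q) =
      mm_inner (mm_mult (mm_unit A p) (mm_unit A q)) (mm_one A)"
    using assms
    by (simp add: mm_coord_hs_adjoint [OF linear_mult_map] mm_tensor_unit [symmetric] mult_map_tensor)
  also have "\<dots> = mm_coord (mm_unit A (flip_idx p)) q"
    using assms by (simp add: mm_inner_mult_one [where A = A] mm_dagger_unit mm_inner_unit_left [where A = A])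
  finally show ?thesis using assms by simp
qed

lemma
  assumes \<Phi>: "linear_map A B \<Phi>"
  shows channel_state_carrier: "channel_state A B \<Phi> \<in> mm_carrier (alg_tensor A B)"
    and mm_coord_channel_state: "p \<in> mm_idx A \<Longrightarrow> q \<in> mm_idx B \<Longrightarrow>
      mm_coord (channel_state A B \<Phi>) (tensor_idx B p q) = mm_coord (\<Phi> (mm_unit A (flip_idx p))) q"
proof -
  let ?t = "hs_adjoint (alg_tensor A A) A (mult_map A) (mm_one A)"
  have id: "linear_map A A (\<lambda>a. a)" by (simp add: semilinear_map_def)
  have t: "?t \<in> mm_carrier (alg_tensor A A)"
    by (simp add: hs_adjoint_carrier [OF linear_mult_map])
  show "channel_state A B \<Phi> \<in> mm_carrier (alg_tensor A B)"
    unfolding channel_state_def by (rule semilinear_mapD(1) [OF linear_map_tensor [OF id \<Phi>] t])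
  assume pq: "p \<in> mm_idx A" "q \<in> mm_idx B"
  have "mm_coord (channel_state A B \<Phi>) (tensor_idx B p q) =
    (\<Sum>p'\<in>mm_idx A. \<Sum>p''\<in>mm_idx A. mm_coord ?t (tensor_idx A p' p'') *
        (mm_coord (mm_unit A p') p * mm_coord (\<Phi> (mm_unit A p'')) q))"
    unfolding channel_state_def by (rule mm_coord_map_tensor [OF id \<Phi> pq t])
  \<comment> \<open>The identity on the first factor fixes \<open>p' = p\<close>, and the entries of
    \<open>?t\<close> then fix \<open>p'' = flip_idx p\<close>.\<close>
  also have "\<dots> = (\<Sum>p'\<in>mm_idx A. \<Sum>p''\<in>mm_idx A. if p'' = flip_idx p' then
      (if p' = p then mm_coord (\<Phi> (mm_unit A p'')) q else 0) else 0)"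
    using pq by (intro sum.cong refl) (auto simp: mm_coord_hs_adjoint_mult_map_one)
  also have "\<dots> = mm_coord (\<Phi> (mm_unit A (flip_idx p))) q"
    using pq by simp
  finally show "mm_coord (channel_state A B \<Phi>) (tensor_idx B p q) = mm_coord (\<Phi> (mm_unit A (flip_idx p))) q" .
qed

lemma
  assumes \<Theta>: "linear_map A A (\<Theta> A \<sigma>)" and \<Phi>: "linear_map A B \<Phi>"
  shows state_over_time_carrier: "state_over_time \<Theta> A B \<Phi> \<sigma> \<in> mm_carrier (alg_tensor A B)"
    and mm_coord_state_over_time: "p \<in> mm_idx A \<Longrightarrow> q \<in> mm_idx B \<Longrightarrow>
      mm_coord (state_over_time \<Theta> A B \<Phi> \<sigma>) (tensor_idx B p q) =
      (\<Sum>p'\<in>mm_idx A. mm_coord (\<Theta> A \<sigma> (mm_unit A p')) p * mm_coord (\<Phi> (mm_unit A (flip_idx p'))) q)"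
proof -
  have id: "linear_map B B (\<lambda>b. b)" by (simp add: semilinear_map_def)
  show "state_over_time \<Theta> A B \<Phi> \<sigma> \<in> mm_carrier (alg_tensor A B)"
    unfolding state_over_time_def
    by (rule semilinear_mapD(1) [OF linear_map_tensor [OF \<Theta> id] channel_state_carrier [OF \<Phi>]])
  assume pq: "p \<in> mm_idx A" "q \<in> mm_idx B"
  have "mm_coord (state_over_time \<Theta> A B \<Phi> \<sigma>) (tensor_idx B p q) =
    (\<Sum>p'\<in>mm_idx A. \<Sum>q'\<in>mm_idx B. mm_coord (channel_state A B \<Phi>) (tensor_idx B p' q') *
        (mm_coord (\<Theta> A \<sigma> (mm_unit A p')) p * mm_coord (mm_unit B q') q))"
    unfolding state_over_time_def
    by (rule mm_coord_map_tensor [OF \<Theta> id pq channel_state_carrier [OF \<Phi>]])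
  also have "\<dots> = (\<Sum>p'\<in>mm_idx A. \<Sum>q'\<in>mm_idx B. if q' = q then
      mm_coord (\<Theta> A \<sigma> (mm_unit A p')) p * mm_coord (\<Phi> (mm_unit A (flip_idx p'))) q' else 0)"
    using pq by (intro sum.cong refl) (auto simp: mm_coord_channel_state [OF \<Phi>])
  finally show "mm_coord (state_over_time \<Theta> A B \<Phi> \<sigma>) (tensor_idx B p q) =
      (\<Sum>p'\<in>mm_idx A. mm_coord (\<Theta> A \<sigma> (mm_unit A p')) p * mm_coord (\<Phi> (mm_unit A (flip_idx p'))) q)"
    using pq by simp
qed

text \<open>The two conjugate-linear daggers around \<open>F\<close> cancel to a linear map.\<close>

lemma linear_tilde_map:
  assumes F: "linear_map A B F"
  shows "linear_map A B (tilde_map F)"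
  unfolding semilinear_map_def tilde_map_def
  by (simp add: semilinear_mapD [OF F] semilinear_mapD(2,3) [OF semilinear_dagger [of A]]
      semilinear_mapD(2,3) [OF semilinear_dagger [of B]])


section \<open>Positive maps\<close>

text \<open>This is the case n = 1: tensoring with the algebra \<open>[1]\<close> changes neither
  the algebra, nor an element, nor the map.\<close>

lemma completely_positive_imp_positive:
  assumes cp: "completely_positive A B \<E>" and a: "a \<in> mm_carrier A" "mm_positive A a"
  shows "mm_positive B (\<E> a)"
proof -
  have L: "linear_map A B \<E>" using cp by (simp add: completely_positive_def)
  have id: "linear_map [1] [1] (\<lambda>a. a)" by (simp add: semilinear_map_def)
  have alg: "alg_tensor [1] C = C" for C :: mm_alg
    by (simp add: alg_tensor_def map_idI)
  have one: "kronecker (1\<^sub>m 1) M = M" for M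
    by (rule eq_matI) (auto simp: kronecker_def)
  have tensor: "mm_tensor [1\<^sub>m 1] c = c" for c
    by (simp add: mm_tensor_def one [unfolded One_nat_def] comp_def)
  have I: "[1\<^sub>m 1] \<in> mm_carrier [1]" by (simp add: mm_carrier_def)
  have "mm_positive (alg_tensor [1] B) (map_tensor [1] A [1] B (\<lambda>a. a) \<E> a)"
    using cp a unfolding completely_positive_def by (metis alg less_numeral_extra(1))
  also have "map_tensor [1] A [1] B (\<lambda>a. a) \<E> a = \<E> a"
    using map_tensor_tensor [OF id L I a(1)] by (simp only: tensor)
  finally show ?thesis by (simp only: alg)
qed

lemma mm_dagger_mult:
  assumes "a \<in> mm_carrier A" "b \<in> mm_carrier A"
  shows "mm_dagger (mm_mult a b) = mm_mult (mm_dagger b) (mm_dagger a)"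
proof (rule mm_eqI [of _ A])
  fix p assume p: "p \<in> mm_idx A"
  obtain x i j where [simp]: "p = (x, i, j)" by (cases p)
  have "(x, i, k) \<in> mm_idx A" "(x, k, j) \<in> mm_idx A" "(x, j, i) \<in> mm_idx A" if "k < A ! x" for k
    using p that by (auto simp: mm_idx_def)
  moreover have "flip_idx p \<in> mm_idx A" using p by simp
  ultimately show "mm_coord (mm_dagger (mm_mult a b)) p = mm_coord (mm_mult (mm_dagger b) (mm_dagger a)) p"
    using p assms by (simp add: mm_coord_mult [where A = A] mm_coord_dagger [where A = A] flip_idx_def mult.commute)
qed (use assms in auto)

lemma mm_mult_one_left: "a \<in> mm_carrier A \<Longrightarrow> mm_mult (mm_one A) a = a"
  by (auto simp: mm_mult_def mm_one_def mm_carrier_def list_eq_iff_nth_eq)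

lemma mm_mult_one_right: "a \<in> mm_carrier A \<Longrightarrow> mm_mult a (mm_one A) = a"
  by (auto simp: mm_mult_def mm_one_def mm_carrier_def list_eq_iff_nth_eq)

lemma mm_dagger_one: "mm_dagger (mm_one A) = mm_one A"
  by (rule mm_eqI [of _ A]) (auto simp: mm_coord_dagger [where A = A] mm_coord_one)

lemma mm_dagger_positive: "mm_positive A a \<Longrightarrow> mm_dagger a = a"
  unfolding mm_positive_def by (auto simp: mm_dagger_mult [where A = A] mm_dagger_dagger [where A = A])

text \<open>An induction principle expressing that positive elements span the algebra over the
  complex numbers.\<close>

lemma positive_span:
  assumes add: "\<And>a b. a \<in> mm_carrier A \<Longrightarrow> b \<in> mm_carrier A \<Longrightarrow> P a \<Longrightarrow> P b \<Longrightarrow> P (mm_add a b)"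
    and smult: "\<And>c a. a \<in> mm_carrier A \<Longrightarrow> P a \<Longrightarrow> P (mm_smult c a)"
    and pos: "\<And>a. a \<in> mm_carrier A \<Longrightarrow> mm_positive A a \<Longrightarrow> P a"
    and a: "a \<in> mm_carrier A"
  shows "P a"
proof -
  define s where "s u = mm_add (mm_smult u (mm_one A)) a" for u
  define sq where "sq u = mm_mult (mm_dagger (s u)) (s u)" for u
  have s: "s u \<in> mm_carrier A" for u by (simp add: s_def a)
  have c: "mm_smult v (sq u) \<in> mm_carrier A" for u v by (simp add: sq_def s)
  have P: "P (mm_smult v (sq u))" for u v
  proof (rule smult)
    show "sq u \<in> mm_carrier A" by (simp add: sq_def s)
    then show "P (sq u)" by (rule pos) (use s in \<open>auto simp: mm_positive_def sq_def\<close>)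
  qed
  note d = mm_dagger_carrier [OF a]
  \<comment> \<open>Multiply by u/4 and sum over the fourth roots of unity u: since u and its square
    both sum to 0, only the \<open>a\<close> term remains, with coefficient 1. The entries of the
    dagger stay unexpanded, as they cancel.\<close>
  have sq: "mm_coord (sq u) p = cnj u * u * mm_coord (mm_one A) p + cnj u * mm_coord a p +
      u * mm_coord (mm_dagger a) p + mm_coord (mm_mult (mm_dagger a) a) p"
    if p: "p \<in> mm_idx A" for u p
  proof -
    have "mm_dagger (s u) = mm_add (mm_smult (cnj u) (mm_one A)) (mm_dagger a)"
      by (simp add: s_def a semilinear_mapD(2,3) [OF semilinear_dagger [of A]] mm_dagger_one)
    \<comment> \<open>Only the left factor of the product is multiplied out in the first summand,
      which leaves \<open>s u\<close> whole there.\<close>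
    then have "sq u = mm_add
        (mm_smult (cnj u) (s u))
        (mm_add (mm_smult u (mm_dagger a)) (mm_mult (mm_dagger a) a))"
      by (simp add: sq_def semilinear_mapD(2,3) [OF linear_mult_left [OF s]] s d mm_mult_one_left)
        (simp add: s_def a semilinear_mapD(2,3) [OF linear_mult_right [OF d]] mm_mult_one_right [OF d])
    then show ?thesis using p a d s
      by (simp add: mm_coord_add [where A = A] mm_coord_smult [where A = A] del: mm_coord_dagger)
        (simp add: s_def mm_coord_add [where A = A] mm_coord_smult [where A = A] algebra_simps del: mm_coord_dagger)
  qed
  \<comment> \<open>polarization: \<open>4a = \<Sum>\<^sub>k \<i>\<^sup>k (\<i>\<^sup>k 1 + a)\<^sup>\<dagger> (\<i>\<^sup>k 1 + a)\<close>\<close>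
  have "a = mm_add (mm_add (mm_smult (1/4) (sq 1)) (mm_smult (\<i>/4) (sq \<i>)))
      (mm_add (mm_smult (-1/4) (sq (-1))) (mm_smult (-\<i>/4) (sq (-\<i>))))" (is "a = ?b")
  proof (rule mm_eqI [OF a])
    show "?b \<in> mm_carrier A" by (intro mm_add_carrier c)
    fix p assume p: "p \<in> mm_idx A"
    have "sq u \<in> mm_carrier A" for u by (simp add: sq_def s)
    then show "mm_coord a p = mm_coord ?b p"
      using p c
      by (simp add: mm_coord_add [where A = A] mm_coord_smult [where A = A] sq algebra_simps
          del: mm_coord_dagger)
  qed
  also have "P ?b" by (intro add mm_add_carrier c P)
  finally show ?thesis .
qed

text \<open>Both sides are conjugate-linear in \<open>a\<close>, so by \<open>positive_span\<close>
  it suffices to compare them on positive elements; there \<open>a\<close> and its image are both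
  fixed by the dagger.\<close>

lemma positive_map_dagger:
  assumes L: "linear_map A B \<E>"
    and pos: "\<And>a. a \<in> mm_carrier A \<Longrightarrow> mm_positive A a \<Longrightarrow> mm_positive B (\<E> a)"
    and a: "a \<in> mm_carrier A"
  shows "\<E> (mm_dagger a) = mm_dagger (\<E> a)"
proof (rule positive_span [where P = "\<lambda>a. \<E> (mm_dagger a) = mm_dagger (\<E> a)", OF _ _ _ a])
  note LA = semilinear_mapD [OF semilinear_dagger [of A]]
  note LB = semilinear_mapD [OF semilinear_dagger [of B]]
  show "\<E> (mm_dagger (mm_add a b)) = mm_dagger (\<E> (mm_add a b))"
    if "a \<in> mm_carrier A" "b \<in> mm_carrier A"
      "\<E> (mm_dagger a) = mm_dagger (\<E> a)" "\<E> (mm_dagger b) = mm_dagger (\<E> b)" for a b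
    using that by (simp add: semilinear_mapD [OF L] LA(2) LB(2))
  show "\<E> (mm_dagger (mm_smult c a)) = mm_dagger (\<E> (mm_smult c a))"
    if "a \<in> mm_carrier A" "\<E> (mm_dagger a) = mm_dagger (\<E> a)" for c a
    using that by (simp add: semilinear_mapD [OF L] LA(3) LB(3))
  show "\<E> (mm_dagger a) = mm_dagger (\<E> a)" if "a \<in> mm_carrier A" "mm_positive A a" for a
    using mm_dagger_positive [OF that(2)] mm_dagger_positive [OF pos [OF that]] by simp
qed


section \<open>Bayes maps\<close>

text \<open>The contraction of the first tensor factor with a matrix unit: self-adjointness moves
  \<open>\<Theta>\<close> from the summation variable onto the fixed unit at \<open>p\<close>, and
  what is left is the expansion of \<open>\<E>\<close> at one element.\<close>

lemma mm_coord_state_over_time_unit: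
  assumes \<Theta>: "linear_map A A (\<Theta> A \<rho>)" and \<E>: "linear_map A B \<E>"
    and self_adjoint: "\<And>a b. a \<in> mm_carrier A \<Longrightarrow> b \<in> mm_carrier A \<Longrightarrow>
      mm_inner (\<Theta> A \<rho> a) b = mm_inner a (\<Theta> A \<rho> b)"
    and p: "p \<in> mm_idx A" and q: "q \<in> mm_idx B"
  shows "mm_coord (state_over_time \<Theta> A B \<E> \<rho>) (tensor_idx B p q) =
    mm_coord (\<E> (mm_dagger (\<Theta> A \<rho> (mm_unit A p)))) q"
proof -
  note T = semilinear_mapD(1) [OF \<Theta> mm_unit_carrier]
  have "mm_coord (state_over_time \<Theta> A B \<E> \<rho>) (tensor_idx B p q) =
      (\<Sum>r\<in>mm_idx A. mm_coord (\<Theta> A \<rho> (mm_unit A r)) p * mm_coord (\<E> (mm_unit A (flip_idx r))) q)"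
    by (rule mm_coord_state_over_time [where \<Theta> = \<Theta> and \<sigma> = \<rho>, OF \<Theta> \<E> p q])
  also have "\<dots> = (\<Sum>r\<in>mm_idx A. mm_coord (mm_dagger (\<Theta> A \<rho> (mm_unit A p))) (flip_idx r) *
      mm_coord (\<E> (mm_unit A (flip_idx r))) q)"
  proof (intro sum.cong refl)
    fix r assume r: "r \<in> mm_idx A"
    have "mm_coord (\<Theta> A \<rho> (mm_unit A r)) p = mm_inner (\<Theta> A \<rho> (mm_unit A p)) (mm_unit A r)"
      by (simp add: self_adjoint mm_inner_unit_left [OF T p])
    also have "\<dots> = mm_coord (mm_dagger (\<Theta> A \<rho> (mm_unit A p))) (flip_idx r)"
      using r by (simp add: mm_inner_unit_right [OF T r] mm_coord_dagger [OF _ T])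
    finally show "mm_coord (\<Theta> A \<rho> (mm_unit A r)) p * mm_coord (\<E> (mm_unit A (flip_idx r))) q =
      mm_coord (mm_dagger (\<Theta> A \<rho> (mm_unit A p))) (flip_idx r) * mm_coord (\<E> (mm_unit A (flip_idx r))) q"
      by simp
  qed
  \<comment> \<open>Every term depends on \<open>r\<close> only through \<open>flip_idx r\<close>,
    so the flip is absorbed by reindexing.\<close>
  also have "\<dots> = mm_coord (\<E> (mm_dagger (\<Theta> A \<rho> (mm_unit A p)))) q"
    by (simp add: sum_flip_idx [where f = "\<lambda>r. mm_coord (mm_dagger (\<Theta> A \<rho> (mm_unit A p))) r *
          mm_coord (\<E> (mm_unit A r)) q"]
        semilinear_expand [OF \<E> refl mm_dagger_carrier [OF T] q])
  finally show ?thesis .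
qed

text \<open>The tilde undoes the dagger on the matrix unit and conjugates the value; as the entries
  of the adjoint are conjugated entries of \<open>G\<close>, the entries of \<open>G\<close> itself
  come out, and the sum is the expansion of \<open>\<Theta>\<close> at an image of
  \<open>G\<close>.\<close>

lemma mm_coord_state_over_time_adjoint:
  assumes \<Theta>: "linear_map B B (\<Theta> B \<sigma>)" and G: "linear_map A B G"
    and p: "p \<in> mm_idx A" and q: "q \<in> mm_idx B"
  shows "mm_coord (state_over_time \<Theta> B A (tilde_map (hs_adjoint A B G)) \<sigma>) (tensor_idx A q p) =
    mm_coord (\<Theta> B \<sigma> (G (mm_unit A (flip_idx p)))) q"
proof -
  note F = linear_map_hs_adjoint [OF G]
  note Gc = semilinear_mapD(1) [OF G mm_unit_carrier]
  have "mm_coord (tilde_map (hs_adjoint A B G) (mm_unit B (flip_idx r))) p =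
      mm_coord (G (mm_unit A (flip_idx p))) r" if r: "r \<in> mm_idx B" for r
    using p r
    by (simp add: tilde_map_def mm_dagger_unit mm_coord_dagger [OF _ semilinear_mapD(1) [OF F]]
        mm_coord_hs_adjoint [OF G] mm_inner_unit_right [OF Gc])
  then have "mm_coord (state_over_time \<Theta> B A (tilde_map (hs_adjoint A B G)) \<sigma>) (tensor_idx A q p) =
      (\<Sum>r\<in>mm_idx B. mm_coord (G (mm_unit A (flip_idx p))) r * mm_coord (\<Theta> B \<sigma> (mm_unit B r)) q)"
    by (simp add: mm_coord_state_over_time [where \<Theta> = \<Theta> and \<sigma> = \<sigma>, OF \<Theta> linear_tilde_map [OF F] q p] mult.commute)
  then show ?thesis
    by (simp add: semilinear_expand [OF \<Theta> refl Gc q])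
qed

lemma bayes_equation_hs_adjoint:
  assumes \<Theta>A: "linear_map A A (\<Theta> A \<rho>)" and \<Theta>B: "linear_map B B (\<Theta> B (\<E> \<rho>))"
    and self_adjoint: "\<And>a b. a \<in> mm_carrier A \<Longrightarrow> b \<in> mm_carrier A \<Longrightarrow>
      mm_inner (\<Theta> A \<rho> a) b = mm_inner a (\<Theta> A \<rho> b)"
    and \<E>: "linear_map A B \<E>"
    and dagger: "\<And>a. a \<in> mm_carrier A \<Longrightarrow> \<E> (mm_dagger a) = mm_dagger (\<E> a)"
    and G: "gen_cond_expectation \<Theta> A B \<E> \<rho> G"
  shows "bayes_equation \<Theta> A B \<E> \<rho> (hs_adjoint A B G)"
proof -
  have LG: "linear_map A B G"
    using G by (simp add: gen_cond_expectation_def)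
  have inter: "\<E> (\<Theta> A \<rho> a) = \<Theta> B (\<E> \<rho>) (G a)" if "a \<in> mm_carrier A" for a
    using G that by (simp add: gen_cond_expectation_def)
  show ?thesis
    unfolding bayes_equation_def
  proof (rule mm_eqI_tensor)
    let ?t = "state_over_time \<Theta> B A (tilde_map (hs_adjoint A B G)) (\<E> \<rho>)"
    have t: "?t \<in> mm_carrier (alg_tensor B A)"
      by (rule state_over_time_carrier [where \<Theta> = \<Theta> and \<sigma> = "\<E> \<rho>", OF \<Theta>B linear_tilde_map [OF linear_map_hs_adjoint [OF LG]]])
    show "state_over_time \<Theta> A B \<E> \<rho> \<in> mm_carrier (alg_tensor A B)"
      by (rule state_over_time_carrier [where \<Theta> = \<Theta> and \<sigma> = \<rho>, OF \<Theta>A \<E>])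
    show "swap_dagger B A ?t \<in> mm_carrier (alg_tensor A B)"
      by (rule semilinear_mapD(1) [OF semilinear_swap_dagger t])
    fix p q assume p: "p \<in> mm_idx A" and q: "q \<in> mm_idx B"
    have T: "\<Theta> A \<rho> (mm_unit A p) \<in> mm_carrier A"
      by (simp add: semilinear_mapD(1) [OF \<Theta>A])
    have "mm_coord (state_over_time \<Theta> A B \<E> \<rho>) (tensor_idx B p q) =
        mm_coord (mm_dagger (\<E> (\<Theta> A \<rho> (mm_unit A p)))) q"
      by (simp add: mm_coord_state_over_time_unit [where \<Theta> = \<Theta> and \<rho> = \<rho>, OF \<Theta>A \<E> self_adjoint p q] dagger [OF T])
    \<comment> \<open>The intertwining equation enters here, at the matrix unit at
      \<open>p\<close>.\<close>
    also have "\<dots> = cnj (mm_coord (\<Theta> B (\<E> \<rho>) (G (mm_unit A p))) (flip_idx q))"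
      using mm_coord_dagger [OF q semilinear_mapD(1) [OF \<E> T]] by (simp add: inter)
    \<comment> \<open>The swap reads the entry at the flipped indices; the flip of \<open>p\<close>
      cancels the one produced by the adjoint of \<open>G\<close>.\<close>
    also have "\<dots> = mm_coord (swap_dagger B A ?t) (tensor_idx B p q)"
      using p q by (simp add: mm_coord_swap_dagger t mm_coord_state_over_time_adjoint [where \<Theta> = \<Theta> and \<sigma> = "\<E> \<rho>", OF \<Theta>B LG])
    finally show "mm_coord (state_over_time \<Theta> A B \<E> \<rho>) (tensor_idx B p q) =
      mm_coord (swap_dagger B A ?t) (tensor_idx B p q)" .
  qed
qed

text \<open>The trace of the adjoint at \<open>b\<close> is the pairing of
  \<open>G (mm_one A)\<close> with \<open>b\<close>, while the trace of \<open>b\<close> is the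
  pairing of the unit with \<open>b\<close>; the inner product is nondegenerate.\<close>

lemma trace_preserving_hs_adjoint_iff:
  assumes G: "linear_map A B G"
  shows "trace_preserving B (hs_adjoint A B G) \<longleftrightarrow> G (mm_one A) = mm_one B"
proof -
  have one: "G (mm_one A) \<in> mm_carrier B" by (simp add: semilinear_mapD(1) [OF G])
  have tr: "mm_trace (hs_adjoint A B G b) = mm_inner (G (mm_one A)) b" if "b \<in> mm_carrier B" for b
    using that by (simp add: mm_trace_inner_one [OF hs_adjoint_carrier [OF G]] hs_adjoint_inner [OF G])
  show ?thesis
  proof
    assume "trace_preserving B (hs_adjoint A B G)"
    then have eq: "mm_inner (G (mm_one A)) b = mm_inner (mm_one B) b" if "b \<in> mm_carrier B" for b
      using tr [OF that] that by (simp add: trace_preserving_def mm_trace_inner_one)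
    show "G (mm_one A) = mm_one B"
    proof (rule mm_eqI [OF one mm_one_carrier])
      fix q assume q: "q \<in> mm_idx B"
      show "mm_coord (G (mm_one A)) q = mm_coord (mm_one B) q"
        using eq [OF mm_unit_carrier, of q] mm_inner_unit_right [OF one q]
          mm_inner_unit_right [OF mm_one_carrier q] by simp
    qed
  next
    assume "G (mm_one A) = mm_one B"
    then show "trace_preserving B (hs_adjoint A B G)"
      by (simp add: trace_preserving_def tr mm_trace_inner_one)
  qed
qed

text \<open>The Bayes equation holds for every \<open>G\<close>, but a Bayes map must also preserve
  the trace, which amounts to \<open>G\<close> being unital. With (T1), intertwining yields only
  that \<open>\<Theta> B (\<E> \<rho>)\<close> agrees on \<open>G (mm_one A)\<close> and
  \<open>mm_one B\<close>. If that map is injective, \<open>G\<close> is unital. If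
  \<open>\<E> \<rho>\<close> is singular, (T1) puts the projection complementary to its support into
  the kernel, so \<open>G\<close> may be altered there and unitality can fail.\<close>

theorem theoremV8:
  fixes \<Theta> :: "mm_alg \<Rightarrow> mm \<Rightarrow> mm \<Rightarrow> mm"
    and A B :: mm_alg
    and \<E> G :: "mm \<Rightarrow> mm"
    and \<rho> :: mm
  assumes "state_rendering \<Theta>"
    and "multi_matrix A" and "multi_matrix B"
    and "cptp A B \<E>"
    and "\<rho> \<in> mm_states A"
    and "gen_cond_expectation \<Theta> A B \<E> \<rho> G"
  shows "bayes_equation \<Theta> A B \<E> \<rho> (hs_adjoint A B G) \<and>
         (bayes_map \<Theta> A B \<E> \<rho> (hs_adjoint A B G) \<longleftrightarrow> G (mm_one A) = mm_one B)"
proof -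
  have cp: "completely_positive A B \<E>" and \<E>: "linear_map A B \<E>" and tp: "trace_preserving A \<E>"
    using assms(4) by (auto simp: cptp_def completely_positive_def)
  have G: "linear_map A B G" using assms(6) by (simp add: gen_cond_expectation_def)
  have \<rho>: "\<rho> \<in> mm_carrier A" "mm_positive A \<rho>" "mm_trace \<rho> = 1"
    using assms(5) by (auto simp: mm_states_def)
  \<comment> \<open>The axioms on \<open>\<Theta> B (\<E> \<rho>)\<close> apply only at states of
    \<open>B\<close>; positivity of the map and trace preservation provide this.\<close>
  have "\<E> \<rho> \<in> mm_states B"
    using \<rho> tp completely_positive_imp_positive [OF cp \<rho>(1,2)]
    by (simp add: mm_states_def semilinear_mapD(1) [OF \<E>] trace_preserving_def)
  then have \<Theta>: "linear_map A A (\<Theta> A \<rho>)" "linear_map B B (\<Theta> B (\<E> \<rho>))"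
    using assms(1,2,3,5) unfolding state_rendering_def by blast+
  \<comment> \<open>This is the self-adjointness in (T4).\<close>
  have "mm_inner (\<Theta> A \<rho> a) b = mm_inner a (\<Theta> A \<rho> b)"
    if "a \<in> mm_carrier A" "b \<in> mm_carrier A" for a b
    using assms(1,2,5) that unfolding state_rendering_def by blast
  then have "bayes_equation \<Theta> A B \<E> \<rho> (hs_adjoint A B G)"
    using positive_map_dagger [OF \<E> completely_positive_imp_positive [OF cp]] \<Theta> \<E> assms(6)
    by (intro bayes_equation_hs_adjoint) auto
  then show ?thesis
    by (simp add: bayes_map_def linear_map_hs_adjoint [OF G] trace_preserving_hs_adjoint_iff [OF G])
qed

end
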